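(* For every positive integer $n$, the symplectically self-polar polytope $P^{\ltimes n}\subset\mathbb{R}^{2n}$ satisfies $$c_{EHZ}(P^{\ltimes n}) = 2+\frac1n .$$
   Context: $\omega$ is the standard symplectic form: on $\mathbb{R}^2$, $\omega((x,y),(x',y'))=xy'-yx'$; $\mathbb{R}^{2n}$ is the direct sum of $n$ copies of $\mathbb{R}^2$ and $\omega$ is the sum of the forms of the copies. In particular $\mathbb{R}^{2n+2}\cong\mathbb{R}^2\times\mathbb{R}^{2n}$ with $\omega((a,b),(a',b'))=\omega(a,a')+\omega(b,b')$. For a convex set $X\subset\mathbb{R}^{2n}$, $X^\omega=\{y\in\mathbb{R}^{2n}: \omega(x,y)\le 1\ \forall x\in X\}$. A convex body (compact convex set) $X$ with the origin in its interior is symplectically self-polar if $X=X^\omega$. $P=\operatorname{conv}\{\pm(1,1),\pm(1,0),\pm(0,1)\}\subset\mathbb{R}^2$ and $e=(1,1)\in P$. For a centrally symmetric convex body $X\subset\mathbb{R}^{2n}$ (with nonempty interior), $\|\cdot\|_X$ is the norm with unit ball $X$, and the symplectic $P$-suspension of $X$ is $$P\ltimes_\omega X=\{(v_1,v_2)\in P\times\mathbb{R}^{2n}: |\omega(e,v_1)|+\|v_2\|_X\le 1\}\subset\mathbb{R}^{2n+2}.$$ Define $P^{\ltimes 1}=P$ and $P^{\ltimes n}=P\ltimes_\omega P^{\ltimes (n-1)}$ for $n>1$. $c_{EHZ}(K)$ is the Ekeland--Hofer--Zehnder capacity of a convex body $K\subset\mathbb{R}^{2n}$ (compact, nonempty interior),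 i.e. the minimum of the actions $\left|\frac12\int_0^T\omega(\gamma(t),\dot\gamma(t))\,dt\right|$ over all (generalized) closed characteristics on $\partial K$: Lipschitz closed curves $\gamma:[0,T]\to\partial K$, $\gamma(0)=\gamma(T)$, with $\dot\gamma(t)\in J N_K(\gamma(t))\setminus\{0\}$ for almost every $t$, where $N_K(x)=\{u:\langle u,y-x\rangle\le 0\ \forall y\in K\}$ is the outer normal cone and $J$ is the linear map with $\omega(x,y)=\langle Jx,y\rangle$. *)

theory Defs
  imports "HOL-Analysis.Analysis" "HOL-Library.Function_Algebras"
begin

text \<open>
  Since the construction recurses over the dimension, vectors of \<open>\<real>\<^sup>m\<close> are sequences
  \<open>nat \<Rightarrow> real\<close> vanishing from index \<open>m\<close> on, i.e. the points of \<^const>\<open>Euclidean_space\<close> \<open>m\<close>.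
  The linear structure is the pointwise one; interiors, frontiers and compactness are always taken
  in the topology \<^const>\<open>Euclidean_space\<close> \<open>m\<close>, never in the ambient sequence space.
\<close>

instantiation "fun" :: (type, real_vector) real_vector
begin

definition scaleR_fun :: "real \<Rightarrow> ('a \<Rightarrow> 'b) \<Rightarrow> 'a \<Rightarrow> 'b"
  where "scaleR_fun r f = (\<lambda>x. r *\<^sub>R f x)"

instance
  by standard (simp_all add: scaleR_fun_def fun_eq_iff scaleR_add_right scaleR_add_left)

end

abbreviation Rspace :: "nat \<Rightarrow> (nat \<Rightarrow> real) set"
  where "Rspace m \<equiv> topspace (Euclidean_space m)"

definition dot :: "nat \<Rightarrow> (nat \<Rightarrow> real) \<Rightarrow> (nat \<Rightarrow> real) \<Rightarrow> real"
  where "dot m x y = (\<Sum>i<m. x i * y i)"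

text \<open>The \<open>k\<close>-th copy of \<open>\<real>\<^sup>2\<close> in \<open>\<real>\<^bsup>2n\<^esup>\<close> has the coordinates \<open>2k\<close> and \<open>2k+1\<close>.\<close>

definition symp :: "nat \<Rightarrow> (nat \<Rightarrow> real) \<Rightarrow> (nat \<Rightarrow> real) \<Rightarrow> real"
  where "symp n x y = (\<Sum>k<n. x (2*k) * y (2*k+1) - x (2*k+1) * y (2*k))"

definition J :: "(nat \<Rightarrow> real) \<Rightarrow> nat \<Rightarrow> real"
  where "J x = (\<lambda>i. if even i then - x (i + 1) else x (i - 1))"

lemma symp_eq_dot_J: "symp n x y = dot (2*n) (J x) y"
  unfolding symp_def dot_def J_def by (induction n) simp_all

definition symp_polar :: "nat \<Rightarrow> (nat \<Rightarrow> real) set \<Rightarrow> (nat \<Rightarrow> real) set"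
  where "symp_polar n X = {y \<in> Rspace (2*n). \<forall>x\<in>X. symp n x y \<le> 1}"

definition symp_self_polar :: "nat \<Rightarrow> (nat \<Rightarrow> real) set \<Rightarrow> bool"
  where "symp_self_polar n X \<longleftrightarrow>
    compactin (Euclidean_space (2*n)) X \<and> convex X \<and>
    0 \<in> Euclidean_space (2*n) interior_of X \<and>
    X = symp_polar n X"

definition vec2 :: "real \<Rightarrow> real \<Rightarrow> nat \<Rightarrow> real"
  where "vec2 a b = (\<lambda>i. if i = 0 then a else if i = 1 then b else 0)"

text \<open>The identification \<open>\<real>\<^sup>2 \<times> \<real>\<^bsup>2n\<^esup> \<cong> \<real>\<^bsup>2n+2\<^esup>\<close>, with the factor \<open>\<real>\<^sup>2\<close> coming first.\<close>

definition join :: "(nat \<Rightarrow> real) \<Rightarrow> (nat \<Rightarrow> real) \<Rightarrow> nat \<Rightarrow> real"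
  where "join v w = (\<lambda>i. if i < 2 then v i else w (i - 2))"

definition P :: "(nat \<Rightarrow> real) set"
  where "P = convex hull {vec2 1 1, - vec2 1 1, vec2 1 0, - vec2 1 0, vec2 0 1, - vec2 0 1}"

text \<open>The Minkowski functional of \<open>X\<close>; for a centrally symmetric convex body \<open>X\<close> it is, on the
  space of \<open>X\<close>, the norm with unit ball \<open>X\<close>.\<close>

definition body_norm :: "(nat \<Rightarrow> real) set \<Rightarrow> (nat \<Rightarrow> real) \<Rightarrow> real"
  where "body_norm X v = Inf {r. 0 < r \<and> (\<exists>x\<in>X. v = r *\<^sub>R x)}"

definition P_suspension :: "nat \<Rightarrow> (nat \<Rightarrow> real) set \<Rightarrow> (nat \<Rightarrow> real) set"
  where "P_suspension n X =
    {join v w | v w. v \<in> P \<and> w \<in> Rspace (2*n) \<and>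
                     \<bar>symp 1 (vec2 1 1) v\<bar> + body_norm X w \<le> 1}"

text \<open>Only exponents \<open>n \<ge> 1\<close> are meaningful; \<open>P_power 0\<close> is left unspecified.\<close>

fun P_power :: "nat \<Rightarrow> (nat \<Rightarrow> real) set" where
  "P_power 0 = undefined"
| "P_power (Suc 0) = P"
| "P_power (Suc (Suc n)) = P_suspension (Suc n) (P_power (Suc n))"

definition normal_cone :: "nat \<Rightarrow> (nat \<Rightarrow> real) set \<Rightarrow> (nat \<Rightarrow> real) \<Rightarrow> (nat \<Rightarrow> real) set"
  where "normal_cone m K x = {u \<in> Rspace m. \<forall>y\<in>K. dot m u (y - x) \<le> 0}"

definition velocity :: "(real \<Rightarrow> nat \<Rightarrow> real) \<Rightarrow> real \<Rightarrow> nat \<Rightarrow> real"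
  where "velocity \<gamma> t = (\<lambda>i. deriv (\<lambda>s. \<gamma> s i) t)"

text \<open>Values of \<open>\<gamma>\<close> outside \<open>{0..T}\<close> are irrelevant: they can affect derivatives only at the two
  endpoints.\<close>

definition closed_characteristic ::
    "nat \<Rightarrow> (nat \<Rightarrow> real) set \<Rightarrow> real \<Rightarrow> (real \<Rightarrow> nat \<Rightarrow> real) \<Rightarrow> bool"
  where "closed_characteristic n K T \<gamma> \<longleftrightarrow>
    0 < T \<and> \<gamma> 0 = \<gamma> T \<and>
    (\<forall>t\<in>{0..T}. \<gamma> t \<in> Euclidean_space (2*n) frontier_of K) \<and>
    (\<exists>L. \<forall>s\<in>{0..T}. \<forall>t\<in>{0..T}. L2_set (\<gamma> s - \<gamma> t) {..<2*n} \<le> L * \<bar>s - t\<bar>) \<and>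
    (AE t in lebesgue_on {0..T}.
       (\<forall>i. (\<lambda>s. \<gamma> s i) differentiable (at t)) \<and>
       velocity \<gamma> t \<in> J ` normal_cone (2*n) K (\<gamma> t) - {0})"

definition symp_action :: "nat \<Rightarrow> real \<Rightarrow> (real \<Rightarrow> nat \<Rightarrow> real) \<Rightarrow> real"
  where "symp_action n T \<gamma> = \<bar>1/2 * integral {0..T} (\<lambda>t. symp n (\<gamma> t) (velocity \<gamma> t))\<bar>"

text \<open>\<open>LEAST\<close> is an attained minimum; the value is unspecified if no minimum exists.\<close>

definition c_EHZ :: "nat \<Rightarrow> (nat \<Rightarrow> real) set \<Rightarrow> real"
  where "c_EHZ n K =
    (LEAST a. \<exists>T \<gamma>. closed_characteristic n K T \<gamma> \<and> a = symp_action n T \<gamma>)"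

end

theory Submission
  imports Defs
begin

text \<open>
  The norm with unit ball \<open>P_power n\<close> satisfies the recursion
  \<open>\<parallel>(x, y, w)\<parallel> = max (max \<bar>x\<bar> \<bar>y\<bar>) (\<bar>x - y\<bar> + \<parallel>w\<parallel>)\<close>. By self-polarity a closed characteristic \<open>\<gamma>\<close> has
  \<open>\<omega>(\<gamma>, \<gamma>') = \<parallel>\<gamma>'\<parallel>\<close>, so its action is half of its length, and the lower bound is an isoperimetric
  inequality. Cut \<open>\<gamma>\<close> into two arcs of equal length \<open>h\<close>: the areas which they enclose with their chords
  add up to the action, and each of them is at most \<open>n h\<^sup>2 / (2 (2n + 1))\<close>. For polygonal arcs this is
  the inequality \<open>\<Sum>i<j. \<omega>(v\<^sub>i, v\<^sub>j) \<le> n / (2n + 1) (\<Sum>i. \<parallel>v\<^sub>i\<parallel>)\<^sup>2\<close>, valid for all vectors \<open>v\<^sub>i\<close>, which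
  is proved by induction on \<open>n\<close>. In the coordinates \<open>m = (x + y) / 2\<close> and \<open>d = y - x\<close> of the first
  plane, \<open>\<omega>\<close> is \<open>m d' - d m'\<close>, and with \<open>h = \<Sum>i. \<parallel>v\<^sub>i\<parallel>\<close> and \<open>\<Lambda> = \<Sum>i. \<bar>d\<^sub>i\<bar>\<close> the plane contributes at most
  \<open>\<Lambda> h - 3/4 \<Lambda>\<^sup>2\<close>, while total length \<open>h - \<Lambda>\<close> is left for the other coordinates. Equality holds for
  \<open>2n + 1\<close> unit vectors with \<open>\<omega>(v\<^sub>i, v\<^sub>j) = 1\<close> for all \<open>i < j\<close>; the centrally symmetric polygon with the
  edges \<open>\<plusminus>v\<^sub>i / n\<close> is a closed characteristic of action \<open>2 + 1/n\<close>.
\<close>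

section \<open>The suspension norm\<close>

definition tail :: "(nat \<Rightarrow> real) \<Rightarrow> nat \<Rightarrow> real"
  where "tail v = (\<lambda>i. v (i + 2))"

text \<open>
  The coordinatewise rules are kept out of the simpset: induction leaves eta-expanded vectors such as
  \<open>\<lambda>i. (x + y) i\<close>, which they would break up.
\<close>

declare plus_fun_apply [simp del] minus_apply [simp del] uminus_apply [simp del]
  zero_fun_apply [simp del]

lemma scaleR_fun_apply: "(c *\<^sub>R f) i = c *\<^sub>R f i"
  by (simp add: scaleR_fun_def)

lemma tail_apply: "tail v i = v (i + 2)"
  by (simp add: tail_def)

lemmas coord = plus_fun_apply minus_apply uminus_apply zero_fun_apply scaleR_fun_apply

lemma coord_0_1 [simp]:
  fixes x y :: "nat \<Rightarrow> real"
  shows "(x + y) 0 = x 0 + y 0" "(x - y) 0 = x 0 - y 0" "(- x) 0 = - x 0"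
    "(0 :: nat \<Rightarrow> real) 0 = 0" "(c *\<^sub>R x) 0 = c * x 0"
    "(x + y) (Suc 0) = x (Suc 0) + y (Suc 0)" "(x - y) (Suc 0) = x (Suc 0) - y (Suc 0)"
    "(- x) (Suc 0) = - x (Suc 0)" "(0 :: nat \<Rightarrow> real) (Suc 0) = 0"
    "(c *\<^sub>R x) (Suc 0) = c * x (Suc 0)"
  by (simp_all add: coord)

lemma tail_linear [simp]:
  "tail (x + y) = tail x + tail y" "tail (x - y) = tail x - tail y"
  "tail (- x) = - tail x" "tail 0 = 0" "tail (c *\<^sub>R x) = c *\<^sub>R tail x"
  by (simp_all add: fun_eq_iff coord tail_apply)

lemma tail_join [simp]: "tail (join v w) = w"
  by (simp add: fun_eq_iff join_def tail_apply)

lemma join_simps [simp]: "join v w 0 = v 0" "join v w (Suc 0) = v 1"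
  by (simp_all add: join_def)

lemma vec2_simps [simp]: "vec2 a b 0 = a" "vec2 a b (Suc 0) = b"
  by (simp_all add: vec2_def)

lemma join_decompose: "v = join (vec2 (v 0) (v 1)) (tail v)"
proof
  fix i
  show "v i = join (vec2 (v 0) (v 1)) (tail v) i"
    by (cases "i < 2") (auto simp: join_def vec2_def tail_apply less_2_cases_iff simp del: add_2_eq_Suc')
qed

lemma Rspace_iff: "v \<in> Rspace m \<longleftrightarrow> (\<forall>i\<ge>m. v i = 0)"
  by (simp add: topspace_Euclidean_space)

lemma Rspace_tail: "v \<in> Rspace (2 * Suc n) \<Longrightarrow> tail v \<in> Rspace (2 * n)"
  by (simp add: Rspace_iff tail_apply)

lemma Rspace_join [simp]: "join v w \<in> Rspace (Suc (Suc m)) \<longleftrightarrow> w \<in> Rspace m"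
proof
  assume *: "join v w \<in> Rspace (Suc (Suc m))"
  show "w \<in> Rspace m"
    unfolding Rspace_iff
  proof (intro allI impI)
    fix i assume "m \<le> i"
    with * have "join v w (i + 2) = 0"
      by (simp add: Rspace_iff)
    then show "w i = 0"
      by (simp add: join_def)
  qed
qed (auto simp: Rspace_iff join_def)

lemma Rspace_linear:
  "0 \<in> Rspace m" "x \<in> Rspace m \<Longrightarrow> y \<in> Rspace m \<Longrightarrow> x + y \<in> Rspace m"
  "x \<in> Rspace m \<Longrightarrow> y \<in> Rspace m \<Longrightarrow> x - y \<in> Rspace m"
  "x \<in> Rspace m \<Longrightarrow> - x \<in> Rspace m" "x \<in> Rspace m \<Longrightarrow> c *\<^sub>R x \<in> Rspace m"
  by (simp_all add: Rspace_iff coord)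

lemma symp_0 [simp]: "symp 0 x y = 0"
  by (simp add: symp_def)

lemma symp_Suc: "symp (Suc n) x y = x 0 * y 1 - x 1 * y 0 + symp n (tail x) (tail y)"
  unfolding symp_def by (subst sum.lessThan_Suc_shift) (simp add: tail_apply)

lemma symp_zero [simp]: "symp n 0 y = 0" "symp n x 0 = 0"
  by (simp_all add: symp_def coord)

lemma symp_linear:
  "symp n (x + y) z = symp n x z + symp n y z"
  "symp n z (x + y) = symp n z x + symp n z y"
  "symp n (x - y) z = symp n x z - symp n y z"
  "symp n z (x - y) = symp n z x - symp n z y"
  "symp n (- x) z = - symp n x z"
  "symp n z (- x) = - symp n z x"
  "symp n (c *\<^sub>R x) z = c * symp n x z"
  "symp n z (c *\<^sub>R x) = c * symp n z x"
  by (induction n arbitrary: x y z; simp add: symp_Suc algebra_simps)+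

lemma symp_sum:
  "symp n (\<Sum>i\<in>I. f i) z = (\<Sum>i\<in>I. symp n (f i) z)"
  "symp n z (\<Sum>i\<in>I. f i) = (\<Sum>i\<in>I. symp n z (f i))"
  by (induction I rule: infinite_finite_induct; simp add: symp_linear)+

lemma symp_commute: "symp n x y = - symp n y x"
  by (simp add: symp_def mult.commute flip: sum_negf)

lemma symp_self [simp]: "symp n x x = 0"
  by (simp add: symp_def mult.commute)

text \<open>It reads only the first \<open>2 * n\<close> coordinates: a seminorm on all sequences, a
  norm on \<open>Rspace (2 * n)\<close>. Starting from the zero space gives the inductions a trivial
  base case, although \<open>P_power 0\<close> is unspecified.\<close>

primrec susp_norm :: "nat \<Rightarrow> (nat \<Rightarrow> real) \<Rightarrow> real" where
  "susp_norm 0 v = 0"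
| "susp_norm (Suc n) v = max (max \<bar>v 0\<bar> \<bar>v 1\<bar>) (\<bar>v 0 - v 1\<bar> + susp_norm n (tail v))"

abbreviation susp_ball :: "nat \<Rightarrow> (nat \<Rightarrow> real) set"
  where "susp_ball n \<equiv> {v \<in> Rspace (2 * n). susp_norm n v \<le> 1}"

lemma susp_norm_nonneg: "0 \<le> susp_norm n v"
  by (cases n) auto

lemma susp_norm_zero [simp]: "susp_norm n 0 = 0"
  by (induction n) auto

lemma susp_norm_scaleR: "susp_norm n (c *\<^sub>R v) = \<bar>c\<bar> * susp_norm n v"
proof (induction n arbitrary: v)
  case (Suc n)
  have "\<bar>c * v 0 - c * v 1\<bar> = \<bar>c\<bar> * \<bar>v 0 - v 1\<bar>"
    by (simp add: abs_mult flip: right_diff_distrib)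
  with Suc show ?case
    by (simp add: abs_mult max_mult_distrib_left distrib_left)
qed simp

lemma susp_norm_minus [simp]: "susp_norm n (- v) = susp_norm n v"
  using susp_norm_scaleR [of n "-1" v] by simp

lemma susp_norm_triangle: "susp_norm n (x + y) \<le> susp_norm n x + susp_norm n y"
proof (induction n arbitrary: x y)
  case (Suc n)
  define A B where "A = susp_norm (Suc n) x" and "B = susp_norm (Suc n) y"
  have A: "\<bar>x 0\<bar> \<le> A" "\<bar>x 1\<bar> \<le> A" "\<bar>x 0 - x 1\<bar> + susp_norm n (tail x) \<le> A"
    and B: "\<bar>y 0\<bar> \<le> B" "\<bar>y 1\<bar> \<le> B" "\<bar>y 0 - y 1\<bar> + susp_norm n (tail y) \<le> B"
    by (simp_all add: A_def B_def)
  have "\<bar>(x + y) 0\<bar> \<le> A + B" "\<bar>(x + y) 1\<bar> \<le> A + B"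
    using A(1,2) B(1,2) by auto
  moreover have "\<bar>(x + y) 0 - (x + y) 1\<bar> + susp_norm n (tail (x + y)) \<le> A + B"
  proof -
    have "\<bar>(x + y) 0 - (x + y) 1\<bar> \<le> \<bar>x 0 - x 1\<bar> + \<bar>y 0 - y 1\<bar>"
      by simp
    moreover have "susp_norm n (tail (x + y)) \<le> susp_norm n (tail x) + susp_norm n (tail y)"
      using Suc by simp
    ultimately show ?thesis
      using A(3) B(3) by linarith
  qed
  ultimately have "susp_norm (Suc n) (x + y) \<le> A + B"
    unfolding susp_norm.simps by (intro max.boundedI)
  then show ?case
    by (simp only: A_def B_def)
qed simp

lemma abs_le_susp_norm: "i < 2 * n \<Longrightarrow> \<bar>v i\<bar> \<le> susp_norm n v"
proof (induction n arbitrary: i v)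
  case (Suc n)
  show ?case
  proof (cases "i < 2")
    case True
    then have "i = 0 \<or> i = 1" by auto
    then show ?thesis by auto
  next
    case False
    then have "\<bar>tail v (i - 2)\<bar> \<le> susp_norm n (tail v)"
      using Suc.prems by (intro Suc.IH) auto
    moreover have "tail v (i - 2) = v i"
      using False by (simp add: tail_apply del: add_2_eq_Suc')
    ultimately have "\<bar>v i\<bar> \<le> \<bar>v 0 - v 1\<bar> + susp_norm n (tail v)" by linarith
    then show ?thesis by (simp add: le_max_iff_disj)
  qed
qed simp

lemma susp_norm_le_sum: "susp_norm n v \<le> (\<Sum>i<2 * n. \<bar>v i\<bar>)"
proof (induction n arbitrary: v)
  case (Suc n)
  have "(\<Sum>i<2 * Suc n. \<bar>v i\<bar>) = \<bar>v 0\<bar> + \<bar>v 1\<bar> + (\<Sum>i<2 * n. \<bar>tail v i\<bar>)"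
    by (simp add: sum.lessThan_Suc_shift tail_apply del: sum.lessThan_Suc)
  moreover have "0 \<le> (\<Sum>i<2 * n. \<bar>tail v i\<bar>)"
    by (rule sum_nonneg) simp
  ultimately show ?case
    using Suc [of "tail v"] by (simp del: sum.lessThan_Suc)
qed simp

section \<open>Self-polarity of the norm\<close>

lemma abs_half_sum_le:
  fixes a b r :: real
  assumes "\<bar>a\<bar> \<le> r" "\<bar>b\<bar> \<le> r"
  shows "\<bar>(a + b) / 2\<bar> \<le> r - \<bar>b - a\<bar> / 2"
  using assms by (auto simp: abs_if field_simps split: if_splits)

text \<open>The larger of two absolute values is the absolute mean plus half the absolute
  difference. Mean and difference of the first two coordinates are the variables in which the
  inductions over \<open>n\<close> are carried out.\<close>

lemma susp_norm_SucD:
  assumes "susp_norm (Suc n) v \<le> r"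
  shows "\<bar>(v 0 + v 1) / 2\<bar> \<le> r - \<bar>v 1 - v 0\<bar> / 2" "\<bar>v 1 - v 0\<bar> \<le> r"
    "susp_norm n (tail v) \<le> r - \<bar>v 1 - v 0\<bar>"
proof -
  show "\<bar>(v 0 + v 1) / 2\<bar> \<le> r - \<bar>v 1 - v 0\<bar> / 2"
    using assms by (intro abs_half_sum_le) auto
  have "\<bar>v 1 - v 0\<bar> + susp_norm n (tail v) \<le> r"
    using assms by (simp add: abs_minus_commute)
  then show "\<bar>v 1 - v 0\<bar> \<le> r" "susp_norm n (tail v) \<le> r - \<bar>v 1 - v 0\<bar>"
    using susp_norm_nonneg [of n "tail v"] by auto
qed

text \<open>One inclusion of self-polarity. The first plane contributes
  \<open>m * d' - d * m'\<close>, and the bounds of \<open>susp_norm_SucD\<close> together with the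
  inductive bound on the tails add up to exactly \<open>A * B\<close>.\<close>

lemma symp_le_susp_norm: "\<bar>symp n x y\<bar> \<le> susp_norm n x * susp_norm n y"
proof (induction n arbitrary: x y)
  case (Suc n)
  define m d m' d' where "m = (x 0 + x 1) / 2" and "d = x 1 - x 0"
    and "m' = (y 0 + y 1) / 2" and "d' = y 1 - y 0"
  define A B where "A = susp_norm (Suc n) x" and "B = susp_norm (Suc n) y"
  note A = susp_norm_SucD [OF order_refl, where n = n and v = x, folded m_def d_def A_def]
    and B = susp_norm_SucD [OF order_refl, where n = n and v = y, folded m'_def d'_def B_def]
  have "symp (Suc n) x y = m * d' - d * m' + symp n (tail x) (tail y)"
    by (simp add: symp_Suc m_def d_def m'_def d'_def field_simps)
  also have "\<bar>\<dots>\<bar> \<le> \<bar>m\<bar> * \<bar>d'\<bar> + \<bar>d\<bar> * \<bar>m'\<bar> + susp_norm n (tail x) * susp_norm n (tail y)"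
    using Suc [of "tail x" "tail y"] unfolding abs_mult [symmetric] by linarith
  also have "\<dots> \<le> (A - \<bar>d\<bar> / 2) * \<bar>d'\<bar> + \<bar>d\<bar> * (B - \<bar>d'\<bar> / 2) + (A - \<bar>d\<bar>) * (B - \<bar>d'\<bar>)"
    using A B susp_norm_nonneg [of n] by (intro add_mono mult_mono) auto
  also have "\<dots> = A * B"
    by (simp add: algebra_simps)
  finally show ?case
    by (simp add: A_def B_def del: susp_norm.simps)
qed simp

text \<open>The other inclusion. Each term of the maximum has its own dual vector: a signed unit
  vector for a single coordinate, and plus or minus (1,1) joined with a dual vector of the tail for
  the last term.\<close>

lemma susp_norm_attained:
  "\<exists>y\<in>susp_ball n. symp n y x = susp_norm n x"
proof (induction n arbitrary: x)
  case 0
  show ?case by (intro bexI [of _ 0]) (auto simp: Rspace_linear)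
next
  case (Suc n)
  from Suc [of "tail x"] obtain w
    where w: "w \<in> susp_ball n" "symp n w (tail x) = susp_norm n (tail x)" by blast
  define s where "s = (if x 0 \<le> x 1 then 1 else - 1 :: real)"
  define t where "t = (if 0 \<le> x 0 then - 1 else 1 :: real)"
  define u where "u = (if 0 \<le> x 1 then 1 else - 1 :: real)"
  note [simp] = symp_Suc s_def t_def u_def
  have *: "join v w' \<in> susp_ball (Suc n)"
    if "max (max \<bar>v 0\<bar> \<bar>v 1\<bar>) (\<bar>v 0 - v 1\<bar> + susp_norm n w') \<le> 1" "w' \<in> Rspace (2 * n)" for v w'
    using that by simp
  consider "susp_norm (Suc n) x = \<bar>x 0\<bar>" | "susp_norm (Suc n) x = \<bar>x 1\<bar>"
    | "susp_norm (Suc n) x = \<bar>x 0 - x 1\<bar> + susp_norm n (tail x)"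
    by (simp add: max_def) argo
  then show ?case
  proof cases
    case 1
    show ?thesis unfolding 1
      by (intro bexI [of _ "join (vec2 0 t) 0"] *) (auto simp: Rspace_linear)
  next
    case 2
    show ?thesis unfolding 2
      by (intro bexI [of _ "join (vec2 u 0) 0"] *) (auto simp: Rspace_linear)
  next
    case 3
    show ?thesis unfolding 3 using w
      by (intro bexI [of _ "join (vec2 s s) w"] *) auto
  qed
qed

lemma symp_polar_susp_ball: "symp_polar n (susp_ball n) = susp_ball n"
proof (intro set_eqI iffI)
  fix y assume "y \<in> symp_polar n (susp_ball n)"
  then show "y \<in> susp_ball n"
    using susp_norm_attained [of n y] by (auto simp: symp_polar_def)
next
  fix y assume y: "y \<in> susp_ball n"
  have "symp n x y \<le> 1" if "x \<in> susp_ball n" for x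
  proof -
    have "\<bar>symp n x y\<bar> \<le> 1 * 1"
      using that y by (intro order_trans [OF symp_le_susp_norm] mult_mono susp_norm_nonneg) auto
    then show ?thesis by simp
  qed
  with y show "y \<in> symp_polar n (susp_ball n)"
    by (simp add: symp_polar_def)
qed

section \<open>The unit ball\<close>

lemma vec_eqI:
  fixes x y :: "nat \<Rightarrow> real"
  assumes "x 0 = y 0" "x (Suc 0) = y (Suc 0)" "tail x = tail y"
  shows "x = y"
  by (metis One_nat_def assms join_decompose)

lemma join_vec2_zero: "join (vec2 a b) 0 = vec2 a b"
  by (auto simp: join_def vec2_def zero_fun_def)

lemma uminus_vec2: "- vec2 a b = vec2 (- a) (- b)"
  by (auto simp: fun_eq_iff vec2_def coord)

lemma convex_susp_ball: "convex (susp_ball n)"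
proof (rule convexI)
  fix x y and u v :: real
  assume *: "x \<in> susp_ball n" "y \<in> susp_ball n" "0 \<le> u" "0 \<le> v" "u + v = 1"
  have "susp_norm n (u *\<^sub>R x + v *\<^sub>R y) \<le> u * susp_norm n x + v * susp_norm n y"
    using susp_norm_triangle [of n "u *\<^sub>R x" "v *\<^sub>R y"] * by (simp add: susp_norm_scaleR)
  also have "\<dots> \<le> u * 1 + v * 1"
    using * by (intro add_mono mult_left_mono) auto
  finally show "u *\<^sub>R x + v *\<^sub>R y \<in> susp_ball n"
    using * by (simp add: Rspace_linear)
qed

lemma susp_norm_eq_0_imp: "v = 0" if "v \<in> Rspace (2 * n)" "susp_norm n v = 0"
proof
  fix i
  show "v i = 0 i"
    using that abs_le_susp_norm [of i n v] by (cases "i < 2 * n") (auto simp: Rspace_iff coord)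
qed

text \<open>The four vertices of the hexagon \<open>P\<close> other than (1,1) and (-1,-1), and a
  copy of \<open>V\<close> over each of these two.\<close>

definition susp_vertices :: "(nat \<Rightarrow> real) set \<Rightarrow> (nat \<Rightarrow> real) set"
  where "susp_vertices V =
    {join (vec2 1 0) 0, join (vec2 (- 1) 0) 0, join (vec2 0 1) 0, join (vec2 0 (- 1)) 0} \<union>
    join (vec2 1 1) ` V \<union> join (vec2 (- 1) (- 1)) ` V"

lemma join_mem_hull:
  assumes "join v ` V \<subseteq> C" "convex C" "w \<in> convex hull V"
  shows "join v w \<in> C"
proof -
  have "convex {w. join v w \<in> C}"
  proof (rule convexI, clarify)
    fix w w' and a b :: real
    assume *: "join v w \<in> C" "join v w' \<in> C" "0 \<le> a" "0 \<le> b" "a + b = 1"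
    have "join v (a *\<^sub>R w + b *\<^sub>R w') = a *\<^sub>R join v w + b *\<^sub>R join v w'"
    proof -
      have b: "b = 1 - a"
        using \<open>a + b = 1\<close> by simp
      show ?thesis
        unfolding b by (rule vec_eqI) (simp_all add: algebra_simps)
    qed
    with * assms(2) show "join v (a *\<^sub>R w + b *\<^sub>R w') \<in> C"
      by (simp add: convexD)
  qed
  then have "convex hull V \<subseteq> {w. join v w \<in> C}"
    using assms(1) by (intro hull_minimal) auto
  with assms(3) show ?thesis by blast
qed

text \<open>A point with coordinate difference \<open>d\<close> is a mixture, with weights
  \<open>\<bar>d\<bar>\<close> and \<open>1 - \<bar>d\<bar>\<close>, of a point \<open>p\<close> on
  an edge of \<open>P\<close> where the difference is 1 or -1 and a point \<open>q\<close> over the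
  diagonal of \<open>P\<close> that carries the tail.\<close>

lemma susp_ball_Suc_hull:
  assumes V: "susp_ball n = convex hull V"
  shows "susp_ball (Suc n) = convex hull (susp_vertices V)"
proof (intro equalityI subsetI)
  fix x assume "x \<in> convex hull (susp_vertices V)"
  moreover have "V \<subseteq> susp_ball n"
    unfolding V by (rule hull_subset)
  then have "susp_vertices V \<subseteq> susp_ball (Suc n)"
    by (auto simp: susp_vertices_def Rspace_linear)
  then have "convex hull (susp_vertices V) \<subseteq> susp_ball (Suc n)"
    by (intro hull_minimal convex_susp_ball)
  ultimately show "x \<in> susp_ball (Suc n)" by blast
next
  fix x assume x: "x \<in> susp_ball (Suc n)"
  define m d where "m = (x 0 + x 1) / 2" and "d = x 1 - x 0"
  define a where "a = \<bar>d\<bar>"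
  have md: "\<bar>m\<bar> \<le> 1 - a / 2" "a \<le> 1" "susp_norm n (tail x) \<le> 1 - a"
    using susp_norm_SucD [of n x 1] x unfolding a_def m_def d_def by blast+
  have "0 \<le> a" by (simp add: a_def)
  define C where "C = convex hull (susp_vertices V)"
  have C: "convex C"
    unfolding C_def by (rule convex_convex_hull)
  have sub: "susp_vertices V \<subseteq> C"
    unfolding C_def by (rule hull_subset)
  \<comment> \<open>\<open>p\<close> and \<open>q\<close> will have the means \<open>t / 2\<close>
    and \<open>t\<close>, so the mixture has mean \<open>t * (1 - a / 2)\<close>; equating this with
    \<open>m\<close> determines \<open>t\<close>.\<close>
  define t where "t = 2 * m / (2 - a)"
  have t: "\<bar>t\<bar> \<le> 1"
    using md by (simp add: t_def abs_mult field_simps)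
  define w where "w = (1 / (1 - a)) *\<^sub>R tail x"
  have tail: "tail x \<in> Rspace (2 * n)"
    using x by (intro Rspace_tail) simp
  \<comment> \<open>For \<open>a = 1\<close> division by zero makes \<open>w\<close> vanish, which
    is correct because the norm bound then forces the tail to be 0.\<close>
  have w: "(1 - a) *\<^sub>R w = tail x"
  proof (cases "a = 1")
    case True
    then have "susp_norm n (tail x) = 0"
      using md susp_norm_nonneg [of n "tail x"] by simp
    then have "tail x = 0"
      by (rule susp_norm_eq_0_imp [OF tail])
    then show ?thesis by (simp add: w_def)
  qed (simp add: w_def)
  have "w \<in> susp_ball n"
    using md tail by (simp add: w_def Rspace_linear susp_norm_scaleR divide_simps)
  then have w_hull: "w \<in> convex hull V"
    by (simp add: V)
  define q where "q = ((1 + t) / 2) *\<^sub>R join (vec2 1 1) w + ((1 - t) / 2) *\<^sub>R join (vec2 (- 1) (- 1)) w"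
  have "q \<in> C"
    unfolding q_def using t sub
    by (intro convexD [OF C] join_mem_hull [OF _ C w_hull])
      (auto simp: susp_vertices_def field_simps)
  define \<sigma> where "\<sigma> = (if 0 \<le> d then 1 else - 1 :: real)"
  define p where "p = ((1 + t) / 2) *\<^sub>R join (vec2 ((1 - \<sigma>) / 2) ((1 + \<sigma>) / 2)) 0 +
    ((1 - t) / 2) *\<^sub>R join (vec2 (- (1 + \<sigma>) / 2) (- (1 - \<sigma>) / 2)) 0"
  have "p \<in> C"
    unfolding p_def using t sub
    by (intro convexD [OF C]) (auto simp: susp_vertices_def field_simps \<sigma>_def)
  have "x = a *\<^sub>R p + (1 - a) *\<^sub>R q"
  proof (rule vec_eqI)
    have m: "m = a * (t / 2) + (1 - a) * t"
    proof -
      have "t * (2 - a) = 2 * m"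
        using \<open>a \<le> 1\<close> by (simp add: t_def)
      then show ?thesis
        by (simp add: algebra_simps)
    qed
    have d: "d = \<sigma> * a"
      by (simp add: \<sigma>_def a_def)
    have "x 0 = m - d / 2" "x (Suc 0) = m + d / 2"
      by (simp_all add: m_def d_def field_simps)
    then show "x 0 = (a *\<^sub>R p + (1 - a) *\<^sub>R q) 0" "x (Suc 0) = (a *\<^sub>R p + (1 - a) *\<^sub>R q) (Suc 0)"
      unfolding m d by (simp_all add: p_def q_def field_simps)
    have "((1 + t) / 2) *\<^sub>R w + ((1 - t) / 2) *\<^sub>R w = w"
      unfolding scaleR_left.add [symmetric] by (simp add: field_simps)
    then have "tail q = w" by (simp add: q_def)
    then show "tail x = tail (a *\<^sub>R p + (1 - a) *\<^sub>R q)"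
      by (simp add: p_def w)
  qed
  also have "\<dots> \<in> C"
    using \<open>p \<in> C\<close> \<open>q \<in> C\<close> \<open>0 \<le> a\<close> md by (intro convexD [OF C]) auto
  finally show "x \<in> convex hull (susp_vertices V)"
    by (simp add: C_def)
qed

lemma susp_ball_0_hull: "susp_ball 0 = convex hull {0}"
  by (auto simp: Rspace_iff zero_fun_def)

lemma polytope_susp_ball: "polytope (susp_ball n)"
proof (induction n)
  case 0
  then show ?case
    unfolding polytope_def susp_ball_0_hull by blast
next
  case (Suc n)
  then obtain V where "finite V" "susp_ball n = convex hull V"
    unfolding polytope_def by blast
  then have "finite (susp_vertices V)"
    by (simp add: susp_vertices_def)
  with susp_ball_Suc_hull [OF \<open>susp_ball n = convex hull V\<close>] show ?case
    unfolding polytope_def by blast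
qed

section \<open>Identification of the powers of \<open>P\<close> with the balls\<close>

lemma P_eq_susp_ball: "P = susp_ball 1"
proof -
  have "susp_ball 1 = convex hull (susp_vertices {0})"
    using susp_ball_Suc_hull [OF susp_ball_0_hull] by simp
  also have "susp_vertices {0} =
      {vec2 1 1, - vec2 1 1, vec2 1 0, - vec2 1 0, vec2 0 1, - vec2 0 1}"
    by (auto simp: susp_vertices_def join_vec2_zero uminus_vec2)
  finally show ?thesis
    by (simp add: P_def)
qed

lemma body_norm_susp_ball:
  assumes "w \<in> Rspace (2 * n)"
  shows "body_norm (susp_ball n) w = susp_norm n w"
proof -
  have "(\<exists>x\<in>susp_ball n. w = r *\<^sub>R x) \<longleftrightarrow> susp_norm n w \<le> r" if "0 < r" for r
  proof
    assume "\<exists>x\<in>susp_ball n. w = r *\<^sub>R x"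
    then obtain x where "susp_norm n x \<le> 1" "w = r *\<^sub>R x" by blast
    then show "susp_norm n w \<le> r"
      using that by (simp add: susp_norm_scaleR)
  next
    assume "susp_norm n w \<le> r"
    then show "\<exists>x\<in>susp_ball n. w = r *\<^sub>R x"
      using that assms
      by (intro bexI [of _ "(1 / r) *\<^sub>R w"]) (simp_all add: susp_norm_scaleR Rspace_linear)
  qed
  then have eq: "{r. 0 < r \<and> (\<exists>x\<in>susp_ball n. w = r *\<^sub>R x)} = {r. 0 < r \<and> susp_norm n w \<le> r}"
    by blast
  show ?thesis
  \<comment> \<open>Only positive factors are allowed, so the set is an open ray at 0 if the norm
    vanishes and a closed ray otherwise.\<close>
  proof (cases "susp_norm n w = 0")
    case True
    then have "{r. 0 < r \<and> susp_norm n w \<le> r} = {0<..}" by auto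
    with True show ?thesis
      unfolding body_norm_def eq by simp
  next
    case False
    then have "{r. 0 < r \<and> susp_norm n w \<le> r} = {susp_norm n w..}"
      using susp_norm_nonneg [of n w] by auto
    then show ?thesis
      unfolding body_norm_def eq by simp
  qed
qed

text \<open>The form with \<open>vec2 1 1\<close> is the coordinate difference, so the suspension
  condition is the last term of the maximum. Membership in \<open>P\<close> adds the two coordinate
  bounds and a bound on the difference that the suspension condition implies.\<close>

lemma P_suspension_susp_ball: "P_suspension n (susp_ball n) = susp_ball (Suc n)"
proof (intro set_eqI iffI)
  fix x assume "x \<in> P_suspension n (susp_ball n)"
  then obtain v w where *: "x = join v w" "v \<in> susp_ball 1" "w \<in> Rspace (2 * n)"
    "\<bar>symp 1 (vec2 1 1) v\<bar> + body_norm (susp_ball n) w \<le> 1"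
    by (auto simp: P_suspension_def P_eq_susp_ball)
  then show "x \<in> susp_ball (Suc n)"
    by (auto simp: body_norm_susp_ball symp_Suc abs_minus_commute)
next
  fix x assume x: "x \<in> susp_ball (Suc n)"
  let ?v = "vec2 (x 0) (x 1)"
  have tail: "tail x \<in> Rspace (2 * n)"
    using x by (intro Rspace_tail) simp
  have "\<bar>x 0 - x 1\<bar> + susp_norm n (tail x) \<le> 1"
    using x by simp
  then have "\<bar>symp 1 (vec2 1 1) ?v\<bar> + body_norm (susp_ball n) (tail x) \<le> 1"
    by (simp add: body_norm_susp_ball [OF tail] symp_Suc abs_minus_commute)
  moreover have "?v \<in> susp_ball 1"
    using x susp_norm_nonneg [of n "tail x"] by (auto simp: Rspace_iff vec2_def)
  moreover note tail
  ultimately show "x \<in> P_suspension n (susp_ball n)"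
    unfolding P_suspension_def P_eq_susp_ball using join_decompose [of x] by blast
qed

lemma P_power_eq_susp_ball: "n \<ge> 1 \<Longrightarrow> P_power n = susp_ball n"
proof (induction n rule: nat_induct_at_least)
  case base
  then show ?case using P_eq_susp_ball by simp
next
  case (Suc n)
  then obtain k where "n = Suc k" by (cases n) auto
  with Suc show ?case
    using P_suspension_susp_ball [of n] by simp
qed

section \<open>Topology of the ball inside the sequence space\<close>

lemma continuous_on_susp_norm: "continuous_on UNIV (susp_norm n)"
proof (induction n)
  case 0
  then show ?case by (simp add: fun_eq_iff)
next
  case (Suc n)
  have "continuous_on UNIV tail"
    unfolding tail_def
    by (intro continuous_on_coordinatewise_then_product continuous_on_product_coordinates)
  then have "continuous_on UNIV (\<lambda>v. susp_norm n (tail v))"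
    by (intro continuous_on_compose2 [OF Suc]) auto
  then show ?case
    by (auto intro!: continuous_intros simp: continuous_on_product_coordinates)
qed

lemma closedin_susp_ball: "closedin (Euclidean_space (2 * n)) (susp_ball n)"
proof -
  have "closed {v. susp_norm n v \<le> 1}"
    using continuous_on_susp_norm by (intro closed_Collect_le) (auto intro: continuous_intros)
  then have "closedin (powertop_real UNIV) {v. susp_norm n v \<le> 1}"
    by (simp add: euclidean_product_topology)
  then show ?thesis
    unfolding Euclidean_space_def closedin_subtopology
    by (intro exI [of _ "{v. susp_norm n v \<le> 1}"]) auto
qed

lemma openin_Euclidean_space_iff:
  "openin (Euclidean_space m) S \<longleftrightarrow> (\<exists>U. open U \<and> S = U \<inter> Rspace m)"
  unfolding Euclidean_space_def openin_subtopology by (simp add: euclidean_product_topology)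

text \<open>In the infinite product the ball is a closed subset of the cube with sides [-1, 1],
  which is compact by Tychonoff's theorem.\<close>

lemma compactin_susp_ball: "compactin (Euclidean_space (2 * n)) (susp_ball n)"
proof -
  have "compactin (powertop_real UNIV) (PiE UNIV (\<lambda>_. {- 1..1}))"
    by (simp add: compactin_PiE)
  then have box: "compact (PiE UNIV (\<lambda>_. {- 1..1}) :: (nat \<Rightarrow> real) set)"
    by (simp add: euclidean_product_topology)
  have "closed (susp_ball n)"
    by (rule closedin_Euclidean_imp_closed [OF closedin_susp_ball])
  moreover have "susp_ball n \<subseteq> PiE UNIV (\<lambda>_. {- 1..1})"
  proof
    fix v assume v: "v \<in> susp_ball n"
    have "\<bar>v i\<bar> \<le> 1" for i
      using v abs_le_susp_norm [of i n v] by (cases "i < 2 * n") (auto simp: Rspace_iff)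
    then show "v \<in> PiE UNIV (\<lambda>_. {- 1..1})"
      by (auto simp: abs_le_iff minus_le_iff)
  qed
  ultimately have "compact (susp_ball n)"
    using closed_Int_compact [OF _ box, of "susp_ball n"] by (simp add: Int_absorb2)
  then show ?thesis
    unfolding Euclidean_space_def compactin_subtopology
    by (auto simp: euclidean_product_topology topspace_Euclidean_space)
qed

lemma zero_interior_susp_ball: "0 \<in> Euclidean_space (2 * n) interior_of susp_ball n"
proof -
  let ?U = "{v :: nat \<Rightarrow> real. (\<Sum>i<2 * n. \<bar>v i\<bar>) < 1}"
  have "open ?U"
    by (intro open_Collect_less continuous_intros continuous_on_product_coordinates)
  then have "openin (Euclidean_space (2 * n)) (?U \<inter> Rspace (2 * n))"
    unfolding openin_Euclidean_space_iff by blast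
  moreover have "?U \<inter> Rspace (2 * n) \<subseteq> susp_ball n"
    using susp_norm_le_sum order_trans less_imp_le by (fastforce simp del: sum.lessThan_Suc)
  moreover have "0 \<in> ?U \<inter> Rspace (2 * n)"
    by (simp add: coord Rspace_linear)
  ultimately show ?thesis
    unfolding interior_of_def by blast
qed

lemma symp_self_polar_susp_ball: "symp_self_polar n (susp_ball n)"
  unfolding symp_self_polar_def
  by (simp only: compactin_susp_ball convex_susp_ball zero_interior_susp_ball symp_polar_susp_ball)

text \<open>By self-polarity, pairing with \<open>v\<close> is at most 1 on the ball; where it
  equals 1, stretching \<open>z\<close> slightly leaves the ball.\<close>

lemma frontier_susp_ball:
  assumes z: "z \<in> susp_ball n" and v: "v \<in> susp_ball n" "symp n z v = 1"
  shows "z \<in> Euclidean_space (2 * n) frontier_of susp_ball n"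
proof -
  have "z \<notin> Euclidean_space (2 * n) interior_of susp_ball n"
  proof
    assume "z \<in> Euclidean_space (2 * n) interior_of susp_ball n"
    then obtain U where U: "open U" "z \<in> U" "U \<inter> Rspace (2 * n) \<subseteq> susp_ball n"
      by (auto simp: interior_of_def openin_Euclidean_space_iff)
    have "continuous_on UNIV (\<lambda>t. t *\<^sub>R z)"
      by (rule continuous_on_coordinatewise_then_product)
        (auto simp: scaleR_fun_apply intro!: continuous_intros)
    then have "open ((\<lambda>t. t *\<^sub>R z) -` U)"
      using U by (simp add: open_vimage)
    moreover have "1 \<in> (\<lambda>t. t *\<^sub>R z) -` U"
      using U by simp
    ultimately obtain \<epsilon> where \<epsilon>: "0 < \<epsilon>" "ball 1 \<epsilon> \<subseteq> (\<lambda>t. t *\<^sub>R z) -` U"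
      by (meson open_contains_ball)
    moreover have "1 + \<epsilon> / 2 \<in> ball 1 \<epsilon>"
      using \<epsilon>(1) by (simp add: dist_real_def)
    ultimately have "(1 + \<epsilon> / 2) *\<^sub>R z \<in> U"
      by blast
    then have "(1 + \<epsilon> / 2) *\<^sub>R z \<in> susp_ball n"
      using U z by (auto simp: Rspace_linear)
    then have "symp n ((1 + \<epsilon> / 2) *\<^sub>R z) v \<le> 1"
      using v symp_polar_susp_ball [of n] unfolding symp_polar_def by blast
    then show False
      using v \<epsilon> by (simp add: symp_linear)
  qed
  then show ?thesis
    using z closedin_susp_ball by (simp add: frontier_of_def closure_of_closedin)
qed

section \<open>The discrete isoperimetric inequality\<close>

text \<open>Passing to all pairs allows the terms with a fixed \<open>i\<close> to be collected;
  \<open>sgn 0 = 0\<close> removes the diagonal.\<close>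

lemma double_sum_sgn:
  fixes g :: "nat \<Rightarrow> nat \<Rightarrow> real"
  shows "(\<Sum>i<N. \<Sum>j<N. sgn (real j - real i) * g i j) = (\<Sum>j<N. \<Sum>i<j. g i j - g j i)"
  by (induction N) (simp_all add: sum.distrib sum_subtractf sum_negf)

text \<open>\<open>\<phi> N i\<close> is the sum of the \<open>d j\<close> after \<open>i\<close>
  minus the sum of those before. Bounding each by the total would give twice the right side;
  antisymmetry of the kernel gains the factor.\<close>

lemma sum_abs_half_sums_le:
  fixes d :: "nat \<Rightarrow> real"
  defines "\<phi> \<equiv> \<lambda>N i. \<Sum>j<N. sgn (real j - real i) * d j"
  shows "(\<Sum>i<N. \<bar>d i\<bar> * \<bar>\<phi> N i\<bar>) \<le> (\<Sum>i<N. \<bar>d i\<bar>)\<^sup>2 / 2"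
proof -
  define e where "e i = (if 0 \<le> d i * \<phi> N i then 1 else - 1 :: real)" for i
  define \<sigma> where "\<sigma> i j = sgn (real j - real i)" for i j
  define X where "X = (\<Sum>i<N. \<Sum>j<N. \<sigma> i j * e i * d i * d j)"
  have e: "e i = 1 \<or> e i = - 1" for i
    by (simp add: e_def)
  have "(\<Sum>i<N. \<bar>d i\<bar> * \<bar>\<phi> N i\<bar>) = (\<Sum>i<N. e i * (d i * \<phi> N i))"
    by (intro sum.cong) (auto simp: e_def simp flip: abs_mult)
  also have "\<dots> = X"
    by (simp add: X_def \<phi>_def \<sigma>_def sum_distrib_left mult_ac)
  finally have eq: "(\<Sum>i<N. \<bar>d i\<bar> * \<bar>\<phi> N i\<bar>) = X" .
  \<comment> \<open>Antisymmetrization of the double sum; then use \<open>\<bar>e i - e j\<bar> = 1 - e i * e j\<close> for signs.\<close>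
  have "X = (\<Sum>i<N. \<Sum>j<N. \<sigma> j i * e j * d j * d i)"
    unfolding X_def by (rule sum.swap)
  also have "\<dots> = (\<Sum>i<N. \<Sum>j<N. - (\<sigma> i j * e j * d i * d j))"
    by (intro sum.cong) (simp_all add: \<sigma>_def sgn_if)
  finally have "2 * X = X + (\<Sum>i<N. \<Sum>j<N. - (\<sigma> i j * e j * d i * d j))"
    by simp
  also have "\<dots> = (\<Sum>i<N. \<Sum>j<N. \<sigma> i j * (e i - e j) * d i * d j)"
    unfolding X_def sum.distrib [symmetric] by (simp add: algebra_simps)
  also have "\<dots> \<le> (\<Sum>i<N. \<Sum>j<N. (1 - e i * e j) * (\<bar>d i\<bar> * \<bar>d j\<bar>))"
  proof (intro sum_mono)
    fix i j
    have "\<bar>\<sigma> i j * (e i - e j)\<bar> \<le> 1 - e i * e j"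
      using e [of i] e [of j] by (auto simp: \<sigma>_def sgn_if)
    then have "\<bar>\<sigma> i j * (e i - e j)\<bar> * (\<bar>d i\<bar> * \<bar>d j\<bar>) \<le> (1 - e i * e j) * (\<bar>d i\<bar> * \<bar>d j\<bar>)"
      by (rule mult_right_mono) simp
    then have "\<bar>\<sigma> i j * (e i - e j) * d i * d j\<bar> \<le> (1 - e i * e j) * (\<bar>d i\<bar> * \<bar>d j\<bar>)"
      by (simp add: abs_mult mult.assoc)
    then show "\<sigma> i j * (e i - e j) * d i * d j \<le> (1 - e i * e j) * (\<bar>d i\<bar> * \<bar>d j\<bar>)"
      by linarith
  qed
  also have "\<dots> = (\<Sum>i<N. \<bar>d i\<bar>)\<^sup>2 - (\<Sum>i<N. e i * \<bar>d i\<bar>)\<^sup>2"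
    by (simp add: power2_eq_square sum_product algebra_simps flip: sum_subtractf)
  also have "\<dots> \<le> (\<Sum>i<N. \<bar>d i\<bar>)\<^sup>2"
    by simp
  finally show ?thesis
    unfolding eq by simp
qed

text \<open>Collecting the terms with \<open>m i\<close> leaves the sum of
  \<open>m i * \<phi> i\<close>. Its estimate contains
  \<open>\<bar>d i\<bar> * \<bar>\<phi> i\<bar> / 2\<close>, which by
  \<open>sum_abs_half_sums_le\<close> sums to at most a quarter of \<open>\<Lambda>\<^sup>2\<close>;
  hence 3/4 = 1 - 1/4.\<close>

lemma sum_planar_area_le:
  fixes m d l :: "nat \<Rightarrow> real"
  assumes m: "\<And>i. i < N \<Longrightarrow> \<bar>m i\<bar> \<le> l i - \<bar>d i\<bar> / 2" and d: "\<And>i. i < N \<Longrightarrow> \<bar>d i\<bar> \<le> l i"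
  defines "\<Lambda> \<equiv> \<Sum>i<N. \<bar>d i\<bar>"
  shows "(\<Sum>j<N. \<Sum>i<j. m i * d j - d i * m j) \<le> \<Lambda> * (\<Sum>i<N. l i) - 3 / 4 * \<Lambda>\<^sup>2"
proof -
  define \<phi> where "\<phi> i = (\<Sum>j<N. sgn (real j - real i) * d j)" for i
  have \<phi>: "\<bar>\<phi> i\<bar> \<le> \<Lambda>" for i
  proof -
    have "\<bar>\<phi> i\<bar> \<le> (\<Sum>j<N. \<bar>sgn (real j - real i) * d j\<bar>)"
      unfolding \<phi>_def by (rule sum_abs)
    also have "\<dots> \<le> \<Lambda>"
      unfolding \<Lambda>_def by (intro sum_mono) (simp add: abs_mult abs_sgn_eq)
    finally show ?thesis .
  qed
  have "(\<Sum>j<N. \<Sum>i<j. m i * d j - d i * m j) = (\<Sum>i<N. m i * \<phi> i)"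
    using double_sum_sgn [where N = N and g = "\<lambda>i j. m i * d j"]
    by (simp add: \<phi>_def sum_distrib_left mult_ac)
  also have "\<dots> \<le> (\<Sum>i<N. \<Lambda> * l i - \<Lambda> * \<bar>d i\<bar> + \<bar>d i\<bar> * \<bar>\<phi> i\<bar> / 2)"
  proof (intro sum_mono)
    fix i assume "i \<in> {..<N}"
    then have i: "i < N" by simp
    have "m i * \<phi> i \<le> \<bar>m i\<bar> * \<bar>\<phi> i\<bar>"
      by (metis abs_ge_self abs_mult)
    also have "\<dots> \<le> (l i - \<bar>d i\<bar> / 2) * \<bar>\<phi> i\<bar>"
      by (intro mult_right_mono m i) simp
    finally have 1: "m i * \<phi> i \<le> (l i - \<bar>d i\<bar> / 2) * \<bar>\<phi> i\<bar>" .
    \<comment> \<open>Replacing \<open>l i * \<bar>\<phi> i\<bar>\<close> by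
      \<open>l i * \<Lambda>\<close> overshoots by the right side; subtracting the left side again
      keeps the estimate sharp.\<close>
    have "\<bar>d i\<bar> * (\<Lambda> - \<bar>\<phi> i\<bar>) \<le> l i * (\<Lambda> - \<bar>\<phi> i\<bar>)"
      using \<phi> [of i] by (intro mult_right_mono d i) simp
    with 1 show "m i * \<phi> i \<le> \<Lambda> * l i - \<Lambda> * \<bar>d i\<bar> + \<bar>d i\<bar> * \<bar>\<phi> i\<bar> / 2"
      by (simp add: algebra_simps)
  qed
  also have "\<dots> = \<Lambda> * (\<Sum>i<N. l i) - \<Lambda> * \<Lambda> + (\<Sum>i<N. \<bar>d i\<bar> * \<bar>\<phi> i\<bar>) / 2"
    by (simp add: sum.distrib sum_subtractf sum_distrib_left sum_divide_distrib \<Lambda>_def)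
  also have "(\<Sum>i<N. \<bar>d i\<bar> * \<bar>\<phi> i\<bar>) \<le> \<Lambda>\<^sup>2 / 2"
    using sum_abs_half_sums_le [where d = d and N = N] by (simp add: \<phi>_def \<Lambda>_def)
  finally show ?thesis
    by (simp add: power2_eq_square)
qed

text \<open>The left side is a concave quadratic in \<open>\<Lambda>\<close> with maximum at
  \<open>2 * h / (2 * n + 3)\<close>, and the defect is a multiple of the corresponding
  square.\<close>

lemma suspension_optimum:
  fixes h \<Lambda> :: real
  shows "\<Lambda> * h - 3 / 4 * \<Lambda>\<^sup>2 + real n / (2 * real n + 1) * (h - \<Lambda>)\<^sup>2 \<le> real (Suc n) / (2 * real (Suc n) + 1) * h\<^sup>2"
proof -
  have "real (Suc n) / (2 * real (Suc n) + 1) * h\<^sup>2 - (\<Lambda> * h - 3 / 4 * \<Lambda>\<^sup>2 + real n / (2 * real n + 1) * (h - \<Lambda>)\<^sup>2)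
      = ((2 * real n + 3) * \<Lambda> - 2 * h)\<^sup>2 / (4 * (2 * real n + 1) * (2 * real n + 3))"
    by (simp add: divide_simps add_nonneg_eq_0_iff) (simp add: algebra_simps power2_eq_square)?
  also have "\<dots> \<ge> 0"
    by simp
  finally show ?thesis
    by (rule diff_ge_0_iff_ge [THEN iffD1])
qed

text \<open>The bounds \<open>l i\<close> are free because the induction passes
  \<open>l i - \<bar>d i\<bar>\<close> to the tails, and because for curves \<open>l i\<close> is
  the length of an arc and \<open>v i\<close> only its chord.\<close>

lemma sum_symp_le:
  fixes n N :: nat
  assumes "\<And>i. i < N \<Longrightarrow> susp_norm n (v i) \<le> l i"
  shows "(\<Sum>j<N. \<Sum>i<j. symp n (v i) (v j)) \<le> real n / (2 * real n + 1) * (\<Sum>i<N. l i)\<^sup>2"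
  using assms
proof (induction n arbitrary: v l)
  case (Suc n)
  define m d where "m i = (v i 0 + v i 1) / 2" and "d i = v i 1 - v i 0" for i
  note * = susp_norm_SucD [OF Suc.prems, folded m_def d_def]
  define \<Lambda> where "\<Lambda> = (\<Sum>i<N. \<bar>d i\<bar>)"
  have "symp (Suc n) (v i) (v j) = (m i * d j - d i * m j) + symp n (tail (v i)) (tail (v j))" for i j
    by (simp add: symp_Suc m_def d_def field_simps)
  then have "(\<Sum>j<N. \<Sum>i<j. symp (Suc n) (v i) (v j)) =
      (\<Sum>j<N. \<Sum>i<j. m i * d j - d i * m j) + (\<Sum>j<N. \<Sum>i<j. symp n (tail (v i)) (tail (v j)))"
    by (simp only: sum.distrib)
  also have "(\<Sum>j<N. \<Sum>i<j. m i * d j - d i * m j) \<le> \<Lambda> * (\<Sum>i<N. l i) - 3 / 4 * \<Lambda>\<^sup>2"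
    unfolding \<Lambda>_def by (rule sum_planar_area_le) (fact *)+
  also have "(\<Sum>j<N. \<Sum>i<j. symp n (tail (v i)) (tail (v j)))
      \<le> real n / (2 * real n + 1) * (\<Sum>i<N. l i - \<bar>d i\<bar>)\<^sup>2"
    by (rule Suc.IH) (fact *)
  also have "(\<Sum>i<N. l i - \<bar>d i\<bar>) = (\<Sum>i<N. l i) - \<Lambda>"
    by (simp add: sum_subtractf \<Lambda>_def)
  also have "(\<Lambda> * (\<Sum>i<N. l i) - 3 / 4 * \<Lambda>\<^sup>2) + real n / (2 * real n + 1) * ((\<Sum>i<N. l i) - \<Lambda>)\<^sup>2
      \<le> real (Suc n) / (2 * real (Suc n) + 1) * (\<Sum>i<N. l i)\<^sup>2"
    by (rule suspension_optimum)
  finally show ?case by simp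
qed simp

section \<open>Lipschitz functions\<close>

lemma lipschitz_deriv_bound:
  fixes f :: "real \<Rightarrow> real"
  assumes lip: "\<And>s t. s \<in> {a..b} \<Longrightarrow> t \<in> {a..b} \<Longrightarrow> \<bar>f s - f t\<bar> \<le> L * \<bar>s - t\<bar>"
    and t: "t \<in> {a<..<b}" "f differentiable at t"
  shows "\<bar>deriv f t\<bar> \<le> L"
proof -
  have "(f has_real_derivative deriv f t) (at t)"
    using t(2) by (simp add: DERIV_deriv_iff_real_differentiable)
  then have "((\<lambda>s. \<bar>(f s - f t) / (s - t)\<bar>) \<longlongrightarrow> \<bar>deriv f t\<bar>) (at t)"
    by (intro tendsto_rabs) (simp add: has_field_derivative_iff)
  moreover have "eventually (\<lambda>s. s \<in> {a<..<b}) (at t)"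
    using t(1) by (intro eventually_at_in_open') auto
  then have "eventually (\<lambda>s. \<bar>(f s - f t) / (s - t)\<bar> \<le> L) (at t)"
    using eventually_neq_at_within [of t]
  proof eventually_elim
    case (elim s)
    then show ?case
      using lip [of s t] t(1) by (simp add: abs_divide divide_le_eq)
  qed
  ultimately show ?thesis
    by (rule tendsto_upperbound) simp
qed

text \<open>Forward difference quotients are integrated exactly through a primitive of the function,
  are bounded by the Lipschitz constant, and converge off a null set; dominated convergence
  concludes.\<close>

lemma lipschitz_has_integral_deriv:
  fixes f :: "real \<Rightarrow> real"
  assumes "a \<le> b"
    and lip: "\<And>s t. s \<in> {a..b} \<Longrightarrow> t \<in> {a..b} \<Longrightarrow> \<bar>f s - f t\<bar> \<le> L * \<bar>s - t\<bar>"
    and N: "negligible N" "\<And>t. t \<in> {a<..<b} - N \<Longrightarrow> f differentiable at t"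
  shows "(deriv f has_integral f b - f a) {a..b}"
proof -
  \<comment> \<open>Continuation by constants gives the forward quotients a meaning near
    \<open>b\<close> and keeps a Lipschitz bound.\<close>
  define g where "g t = f (max a (min b t))" for t
  have g_eq: "g t = f t" if "t \<in> {a..b}" for t
    using that by (simp add: g_def)
  have L: "\<bar>g s - g t\<bar> \<le> \<bar>L\<bar> * \<bar>s - t\<bar>" for s t
  proof -
    have "\<bar>g s - g t\<bar> \<le> L * \<bar>max a (min b s) - max a (min b t)\<bar>"
      unfolding g_def using \<open>a \<le> b\<close> by (intro lip) auto
    also have "\<dots> \<le> \<bar>L\<bar> * \<bar>s - t\<bar>"
      by (intro mult_mono) auto
    finally show ?thesis .
  qed
  have cont: "continuous_on A g" for A
  proof -
    have "\<bar>L\<bar>-lipschitz_on A g"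
      using L by (auto simp: lipschitz_on_def dist_real_def)
    then show ?thesis
      by (rule lipschitz_on_continuous_on)
  qed
  \<comment> \<open>Starting at \<open>a - 1\<close> makes \<open>a\<close> an interior point, so
    that two-sided derivatives exist on \<open>{a..b}\<close>.\<close>
  define G where "G x = integral {a - 1..x} g" for x
  have G: "(G has_real_derivative g x) (at x within A)" if "a - 1 < x" for x A
  proof -
    have "(G has_real_derivative g x) (at x within {a - 1..x + 1})"
      unfolding G_def using that by (intro integral_has_real_derivative cont) auto
    then have "(G has_real_derivative g x) (at x)"
      using that by (simp add: at_within_Icc_at)
    then show ?thesis
      by (rule has_field_derivative_at_within)
  qed
  define h where "h k = 1 / real (Suc k)" for k
  have h: "0 < h k" for k
    by (simp add: h_def)
  have h_lim: "filterlim h (at 0) sequentially"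
  proof (rule filterlim_atI)
    show "h \<longlonglongrightarrow> 0"
      unfolding h_def inverse_eq_divide [symmetric] by (rule LIMSEQ_inverse_real_of_nat)
    show "\<forall>\<^sub>F k in sequentially. h k \<noteq> 0"
      using h by (simp add: less_imp_neq [THEN not_sym])
  qed
  define D where "D k t = (g (t + h k) - g t) / h k" for k t
  define y where "y k = (G (b + h k) - G b) / h k - (G (a + h k) - G a) / h k" for k
  have D: "(D k has_integral y k) {a..b}" for k
  proof -
    have G': "((\<lambda>t. (G (t + h k) - G t) / h k) has_vector_derivative D k x) (at x within {a..b})"
      if "x \<in> {a..b}" for x
    proof -
      have "((\<lambda>t. G (t + h k)) has_real_derivative g (x + h k)) (at x)"
        using that h [of k] by (intro DERIV_shift [THEN iffD1] G) auto
      then have "((\<lambda>t. (G (t + h k) - G t) / h k) has_real_derivative D k x) (at x)"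
        unfolding D_def using that by (intro DERIV_cdivide DERIV_diff G) auto
      then show ?thesis
        by (simp add: has_field_derivative_at_within flip: has_real_derivative_iff_has_vector_derivative)
    qed
    have "y k = (G (b + h k) - G b) / h k - (G (a + h k) - G a) / h k"
      by (simp add: y_def)
    with fundamental_theorem_of_calculus [OF \<open>a \<le> b\<close> G']
    show ?thesis
      by simp
  qed
  have y: "y \<longlonglongrightarrow> f b - f a"
  proof -
    have "(\<lambda>k. (G (x + h k) - G x) / h k) \<longlonglongrightarrow> g x" if "a \<le> x" for x
      using that filterlim_compose [OF _ h_lim] G [of x UNIV] by (simp add: DERIV_def)
    from tendsto_diff [OF this this, of b a] show ?thesis
      using \<open>a \<le> b\<close> by (simp add: y_def [abs_def] g_eq)
  qed
  define S where "S = {a<..<b} - N"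
  have bad: "negligible (N \<union> {a, b})"
    using N(1) by simp
  have lim: "(\<lambda>k. D k t) \<longlonglongrightarrow> deriv f t" if "t \<in> S" for t
  proof -
    have t: "t \<in> {a<..<b}" "f differentiable at t"
      using that N(2) by (auto simp: S_def)
    then have "(f has_real_derivative deriv f t) (at t)"
      by (simp add: DERIV_deriv_iff_real_differentiable)
    moreover have "eventually (\<lambda>s. g s = f s) (nhds t)"
      using t(1) by (intro eventually_nhds_in_open [THEN eventually_mono, of "{a<..<b}"]) (auto simp: g_eq)
    ultimately have "(g has_real_derivative deriv f t) (at t)"
      using DERIV_cong_ev [OF refl _ refl] by blast
    then show ?thesis
      unfolding DERIV_def D_def by (rule filterlim_compose [OF _ h_lim])
  qed
  have "((\<lambda>t. if t \<in> S then deriv f t else 0) has_integral (f b - f a)) {a..b}"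
  proof (rule has_integral_dominated_convergence [OF _ _ _ _ y])
    show "((\<lambda>t. if t \<in> S then D k t else 0) has_integral y k) {a..b}" for k
      by (rule has_integral_spike [OF bad _ D]) (auto simp: S_def)
    show "(\<lambda>_. \<bar>L\<bar>) integrable_on {a..b}"
      by (rule integrable_const_ivl)
    have "\<bar>D k t\<bar> \<le> \<bar>L\<bar>" for k t
      using L [of "t + h k" t] h [of k] by (simp add: D_def abs_divide divide_le_eq)
    then show "\<forall>t\<in>{a..b}. norm (if t \<in> S then D k t else 0) \<le> \<bar>L\<bar>" for k
      by simp
    show "\<forall>t\<in>{a..b}. (\<lambda>k. if t \<in> S then D k t else 0) \<longlonglongrightarrow> (if t \<in> S then deriv f t else 0)"
      using lim by auto
  qed
  then show ?thesis
    by (rule has_integral_spike [OF bad, rotated]) (auto simp: S_def)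
qed

section \<open>Closed characteristics\<close>

text \<open>
  The velocity is replaced by \<open>w\<close>, which vanishes on the null set where the velocity is undefined
  or outside the cone, so that all conditions hold everywhere.
\<close>

locale polar_curve =
  fixes n :: nat and T :: real and \<gamma> w :: "real \<Rightarrow> nat \<Rightarrow> real" and B :: real
  assumes T: "0 < T"
    and closed: "\<gamma> 0 = \<gamma> T"
    and curve: "t \<in> {0..T} \<Longrightarrow> \<gamma> t \<in> Rspace (2 * n)"
    and has_integral_w: "i < 2 * n \<Longrightarrow> 0 \<le> p \<Longrightarrow> p \<le> q \<Longrightarrow> q \<le> T \<Longrightarrow>
      ((\<lambda>t. w t i) has_integral \<gamma> q i - \<gamma> p i) {p..q}"
    and norm_w: "t \<in> {0..T} \<Longrightarrow> susp_norm n (w t) \<le> symp n (\<gamma> t) (w t)"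
    and bound: "t \<in> {0..T} \<Longrightarrow> symp n (\<gamma> t) (w t) \<le> B"
    and integrable: "(\<lambda>t. symp n (\<gamma> t) (w t)) integrable_on {0..T}"
begin

text \<open>By \<open>norm_w\<close> this bounds the length in \<open>susp_norm\<close> from above;
  over the whole period it is also twice the action.\<close>

definition len :: "real \<Rightarrow> real \<Rightarrow> real"
  where "len p q = integral {p..q} (\<lambda>t. symp n (\<gamma> t) (w t))"

lemma integrable_sub:
  assumes "0 \<le> p" "q \<le> T"
  shows "(\<lambda>t. symp n (\<gamma> t) (w t)) integrable_on {p..q}"
  using integrable_on_subinterval [OF integrable] assms by simp

lemma speed_nonneg: "t \<in> {0..T} \<Longrightarrow> 0 \<le> symp n (\<gamma> t) (w t)"
  using norm_w susp_norm_nonneg order_trans by blast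

lemma len_nonneg: "0 \<le> p \<Longrightarrow> q \<le> T \<Longrightarrow> 0 \<le> len p q"
  unfolding len_def by (intro integral_nonneg integrable_sub speed_nonneg) auto

lemma len_le:
  assumes "0 \<le> p" "p \<le> q" "q \<le> T"
  shows "len p q \<le> B * (q - p)"
proof -
  have "len p q \<le> integral {p..q} (\<lambda>_. B)"
    unfolding len_def using assms
    by (intro integral_le integrable_sub bound integrable_const_ivl) auto
  then show ?thesis
    using assms by (simp add: mult.commute)
qed

lemma len_combine:
  assumes "0 \<le> p" "p \<le> r" "r \<le> q" "q \<le> T"
  shows "len p r + len r q = len p q"
  unfolding len_def using assms
  by (intro Henstock_Kurzweil_Integration.integral_combine integrable_sub) auto

lemma has_integral_symp:
  assumes "0 \<le> p" "p \<le> q" "q \<le> T"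
  shows "((\<lambda>t. symp n x (w t)) has_integral symp n x (\<gamma> q - \<gamma> p)) {p..q}"
  unfolding symp_def
  by (intro has_integral_sum has_integral_diff has_integral_mult_right)
    (use assms has_integral_w in \<open>auto simp: coord\<close>)

text \<open>The displacement is tested against a dual vector \<open>y\<close> in the ball, and
  \<open>symp n y (w t)\<close> is pointwise at most the norm of \<open>w t\<close>.\<close>

lemma displacement_le_len:
  assumes "0 \<le> p" "p \<le> q" "q \<le> T"
  shows "susp_norm n (\<gamma> q - \<gamma> p) \<le> len p q"
proof -
  obtain y where y: "y \<in> susp_ball n" "symp n y (\<gamma> q - \<gamma> p) = susp_norm n (\<gamma> q - \<gamma> p)"
    using susp_norm_attained by blast
  have "symp n y (w t) \<le> symp n (\<gamma> t) (w t)" if "t \<in> {p..q}" for t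
  proof -
    have "symp n y (w t) \<le> susp_norm n y * susp_norm n (w t)"
      using symp_le_susp_norm [of n y "w t"] by linarith
    also have "\<dots> \<le> 1 * susp_norm n (w t)"
      using y by (intro mult_right_mono susp_norm_nonneg) auto
    also have "\<dots> \<le> symp n (\<gamma> t) (w t)"
      using norm_w that assms by simp
    finally show ?thesis .
  qed
  then show ?thesis
    unfolding y(2) [symmetric] len_def using assms
    by (intro has_integral_le [OF has_integral_symp integrable_integral [OF integrable_sub]]) auto
qed

text \<open>Twice the signed area between the arc and its chord, obtained by moving the base point
  of the form to \<open>\<gamma> p\<close>.\<close>

definition area :: "real \<Rightarrow> real \<Rightarrow> real"
  where "area p q = len p q - symp n (\<gamma> p) (\<gamma> q - \<gamma> p)"

lemma has_integral_area:
  assumes "0 \<le> p" "p \<le> q" "q \<le> T"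
  shows "((\<lambda>t. symp n (\<gamma> t - \<gamma> p) (w t)) has_integral area p q) {p..q}"
  unfolding area_def len_def symp_linear using assms
  by (intro has_integral_diff has_integral_symp [unfolded symp_linear] integrable_integral integrable_sub) auto

text \<open>The constant is crude, but the bound is of second order in the length, so its sum over a
  fine partition is negligible.\<close>

lemma area_le_len_squared:
  assumes "0 \<le> p" "p \<le> q" "q \<le> T"
  shows "area p q \<le> (len p q)\<^sup>2"
proof -
  have "symp n (\<gamma> t - \<gamma> p) (w t) \<le> len p q * symp n (\<gamma> t) (w t)" if t: "t \<in> {p..q}" for t
  proof -
    have "symp n (\<gamma> t - \<gamma> p) (w t) \<le> susp_norm n (\<gamma> t - \<gamma> p) * susp_norm n (w t)"
      using symp_le_susp_norm [of n "\<gamma> t - \<gamma> p" "w t"] by linarith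
    also have "\<dots> \<le> len p q * symp n (\<gamma> t) (w t)"
    proof (intro mult_mono susp_norm_nonneg)
      have "susp_norm n (\<gamma> t - \<gamma> p) \<le> len p t"
        using assms t by (intro displacement_le_len) auto
      also have "\<dots> \<le> len p q"
        using len_combine [of p t q] len_nonneg [of t q] assms t by auto
      finally show "susp_norm n (\<gamma> t - \<gamma> p) \<le> len p q" .
    qed (use assms t norm_w len_nonneg in auto)
    finally show ?thesis .
  qed
  moreover have "((\<lambda>t. len p q * symp n (\<gamma> t) (w t)) has_integral len p q * len p q) {p..q}"
    unfolding len_def [of p q]
    using integrable_sub [of p q] assms by (intro has_integral_mult_right integrable_integral) auto
  ultimately show ?thesis
    unfolding power2_eq_square using has_integral_le [OF has_integral_area [OF assms]] by blast
qed

text \<open>The inscribed polygon obeys \<open>sum_symp_le\<close>, and refining it makes the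
  slivers between polygon and arc arbitrarily small.\<close>

lemma area_le:
  assumes "0 \<le> a" "a \<le> b" "b \<le> T"
  shows "area a b \<le> n / (2 * n + 1) * (len a b)\<^sup>2"
proof (rule field_le_epsilon)
  fix e :: real assume "0 < e"
  \<comment> \<open>Each of \<open>M\<close> pieces has length at most
    \<open>B * (b - a) / M\<close>, so the squared lengths add up to at most
    \<open>D / M\<close>.\<close>
  define D where "D = (B * (b - a))\<^sup>2"
  obtain M :: nat where M: "D / e < M"
    using reals_Archimedean2 by blast
  have "0 \<le> D" by (simp add: D_def)
  with \<open>0 < e\<close> M have "0 < M"
    by (metis divide_nonneg_pos less_le_trans not_le of_nat_0 of_nat_0_less_iff le_less_trans)
  have "D / M \<le> e"
    using \<open>0 < M\<close> M \<open>0 < e\<close> by (simp add: field_simps)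
  define \<tau> where "\<tau> j = a + (b - a) * (j / M)" for j :: nat
  have \<tau>0: "\<tau> 0 = a" and \<tau>M: "\<tau> M = b"
    using \<open>0 < M\<close> by (simp_all add: \<tau>_def)
  have \<tau>_mono: "\<tau> i \<le> \<tau> j" if "i \<le> j" for i j
    unfolding \<tau>_def using that assms \<open>0 < M\<close> by (intro add_left_mono mult_left_mono divide_right_mono) auto
  have \<tau>_bounds: "0 \<le> \<tau> j" "a \<le> \<tau> j" "j \<le> M \<Longrightarrow> \<tau> j \<le> T" for j
    using \<tau>_mono [of 0 j] \<tau>_mono [of j M] assms by (simp_all add: \<tau>0 \<tau>M)
  define l where "l j = len (\<tau> j) (\<tau> (Suc j))" for j
  define v where "v j = \<gamma> (\<tau> (Suc j)) - \<gamma> (\<tau> j)" for j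
  have l_sum: "(\<Sum>j<k. l j) = len a (\<tau> k)" if "k \<le> M" for k
    using that
  proof (induction k)
    case 0
    then show ?case by (simp add: \<tau>0 len_def)
  next
    case (Suc k)
    then show ?case
      using len_combine [of a "\<tau> k" "\<tau> (Suc k)"] \<tau>_bounds \<tau>_mono assms
      by (simp add: l_def)
  qed
  have v_sum: "(\<Sum>i<j. v i) = \<gamma> (\<tau> j) - \<gamma> a" for j
    unfolding v_def by (subst sum_lessThan_telescope) (simp add: \<tau>0)
  \<comment> \<open>A further piece adds its own sliver and the triangle spanned by the chord to
    \<open>\<tau> k\<close> and the next edge; that chord is the sum of the earlier edges.\<close>
  have split: "area a (\<tau> k) = (\<Sum>j<k. \<Sum>i<j. symp n (v i) (v j)) + (\<Sum>j<k. area (\<tau> j) (\<tau> (Suc j)))"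
    if "k \<le> M" for k
    using that
  proof (induction k)
    case 0
    then show ?case by (simp add: \<tau>0 area_def len_def)
  next
    case (Suc k)
    have "len a (\<tau> (Suc k)) = len a (\<tau> k) + len (\<tau> k) (\<tau> (Suc k))"
      using len_combine [of a "\<tau> k" "\<tau> (Suc k)"] \<tau>_bounds \<tau>_mono Suc.prems assms by simp
    then have "area a (\<tau> (Suc k)) = area a (\<tau> k) + symp n (\<gamma> (\<tau> k) - \<gamma> a) (v k) + area (\<tau> k) (\<tau> (Suc k))"
      by (simp add: area_def v_def symp_linear)
    also have "symp n (\<gamma> (\<tau> k) - \<gamma> a) (v k) = (\<Sum>i<k. symp n (v i) (v k))"
      by (simp add: symp_sum flip: v_sum)
    finally show ?case
      using Suc by simp
  qed
  have l_le: "l j \<le> B * (b - a) / M" and l_nonneg: "0 \<le> l j" and v_le: "susp_norm n (v j) \<le> l j"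
    and area_le': "area (\<tau> j) (\<tau> (Suc j)) \<le> (l j)\<^sup>2" if "j < M" for j
  proof -
    note * = \<tau>_bounds(1) [of j] \<tau>_mono [of j "Suc j"] \<tau>_bounds(3) [of "Suc j"]
    have "\<tau> (Suc j) - \<tau> j = (b - a) / M"
      by (simp add: \<tau>_def algebra_simps add_divide_distrib)
    then show "l j \<le> B * (b - a) / M"
      using len_le [of "\<tau> j" "\<tau> (Suc j)"] * that by (simp add: l_def)
    show "0 \<le> l j"
      unfolding l_def using * that by (intro len_nonneg) auto
    show "susp_norm n (v j) \<le> l j"
      unfolding l_def v_def using * that by (intro displacement_le_len) auto
    show "area (\<tau> j) (\<tau> (Suc j)) \<le> (l j)\<^sup>2"
      unfolding l_def using * that by (intro area_le_len_squared) auto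
  qed
  have "(\<Sum>j<M. area (\<tau> j) (\<tau> (Suc j))) \<le> (\<Sum>j<M. (B * (b - a) / M)\<^sup>2)"
    by (intro sum_mono order_trans [OF area_le'] power_mono l_le l_nonneg) auto
  also have "\<dots> = D / M"
    using \<open>0 < M\<close> by (simp add: D_def power2_eq_square)
  finally have "(\<Sum>j<M. area (\<tau> j) (\<tau> (Suc j))) \<le> e"
    using \<open>D / M \<le> e\<close> by simp
  moreover have "(\<Sum>j<M. \<Sum>i<j. symp n (v i) (v j)) \<le> n / (2 * n + 1) * (\<Sum>j<M. l j)\<^sup>2"
    using sum_symp_le [of M n v l] v_le by (simp add: add.commute)
  ultimately show "area a b \<le> n / (2 * n + 1) * (len a b)\<^sup>2 + e"
    using split [of M] l_sum [of M] by (simp add: \<tau>M)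
qed

text \<open>On a closed curve the chord terms of two complementary arcs cancel, so their areas add
  up to the total. Using \<open>area_le\<close> on two halves gains a factor 2 over using it on the
  whole curve.\<close>

lemma len_total_le: "len 0 T \<le> n / (2 * (2 * n + 1)) * (len 0 T)\<^sup>2"
proof -
  define F where "F = len 0 T"
  have "0 \<le> F"
    unfolding F_def using T by (intro len_nonneg) auto
  have "continuous_on {0..T} (len 0)"
    unfolding len_def by (rule indefinite_integral_continuous_1 [OF integrable])
  moreover have "len 0 0 = 0"
    by (simp add: len_def)
  ultimately obtain s where s: "0 \<le> s" "s \<le> T" "len 0 s = F / 2"
    using IVT' [of "len 0" 0 "F / 2" T] T \<open>0 \<le> F\<close> by (auto simp: F_def)
  then have s': "len s T = F / 2"
    using len_combine [of 0 s T] by (simp add: F_def)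
  have "F = area 0 s + area s T"
    using symp_commute [of n "\<gamma> 0" "\<gamma> s"]
    by (simp add: area_def s s' symp_linear flip: closed)
  also have "\<dots> \<le> n / (2 * n + 1) * (F / 2)\<^sup>2 + n / (2 * n + 1) * (F / 2)\<^sup>2"
    using area_le [of 0 s] area_le [of s T] s(1,2) unfolding s(3) s' by (intro add_mono) auto
  also have "\<dots> = n / (2 * (2 * n + 1)) * F\<^sup>2"
  proof -
    have "c * (F / 2)\<^sup>2 + c * (F / 2)\<^sup>2 = c / 2 * F\<^sup>2" for c :: real
      by (simp add: power2_eq_square)
    from this [of "n / (2 * n + 1)"] show ?thesis
      by (simp add: mult.commute)
  qed
  finally show ?thesis
    by (simp add: F_def)
qed

end

section \<open>Closed characteristics as instances of the locale\<close>

lemma symp_J: "symp n y (J u) = dot (2 * n) u y"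
  by (induction n) (simp_all add: symp_def dot_def J_def)

lemma J_Rspace: "u \<in> Rspace (2 * n) \<Longrightarrow> J u \<in> Rspace (2 * n)"
  unfolding Rspace_iff J_def
proof (intro allI impI)
  fix i assume u: "\<forall>i\<ge>2 * n. u i = 0" and i: "2 * n \<le> i"
  show "(if even i then - u (i + 1) else u (i - 1)) = 0"
  proof (cases "even i")
    \<comment> \<open>An odd index that is at least \<open>2 * n\<close> exceeds it, so
      \<open>i - 1\<close> still lies outside the range.\<close>
    case False
    then have "2 * n \<noteq> i" by auto
    with i u show ?thesis by simp
  qed (use i u in simp)
qed

text \<open>A normal vector \<open>u\<close> at \<open>x\<close> satisfies
  \<open>dot (2 * n) u y \<le> dot (2 * n) u x\<close> on the ball, and
  \<open>dot (2 * n) u y\<close> is \<open>symp n y (J u)\<close>; a dual vector \<open>y\<close> of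
  \<open>J u\<close> turns this into the norm.\<close>

lemma susp_norm_velocity_le:
  assumes "u \<in> normal_cone (2 * n) (susp_ball n) x"
  shows "susp_norm n (J u) \<le> symp n x (J u)"
proof -
  obtain y where y: "y \<in> susp_ball n" "symp n y (J u) = susp_norm n (J u)"
    using susp_norm_attained by blast
  have "dot (2 * n) u (y - x) \<le> 0"
    using assms y(1) unfolding normal_cone_def by blast
  then show ?thesis
    unfolding y(2) [symmetric] symp_J by (simp add: dot_def coord algebra_simps sum_subtractf)
qed

lemma abs_le_L2_set: "i < (m::nat) \<Longrightarrow> \<bar>x i\<bar> \<le> L2_set x {..<m}"
  using member_le_L2_set [of "{..<m}" i "\<lambda>i. \<bar>x i\<bar>"] by (simp add: L2_set_def)

lemma closed_characteristic_action:
  assumes "closed_characteristic n (susp_ball n) T \<gamma>"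
  shows "\<exists>F>0. symp_action n T \<gamma> = F / 2 \<and> F \<le> n / (2 * (2 * n + 1)) * F\<^sup>2"
proof -
  let ?v = "velocity \<gamma>"
  obtain L where T: "0 < T" and closed: "\<gamma> 0 = \<gamma> T"
    and frontier: "\<And>t. t \<in> {0..T} \<Longrightarrow> \<gamma> t \<in> Euclidean_space (2 * n) frontier_of susp_ball n"
    and L: "\<And>s t. s \<in> {0..T} \<Longrightarrow> t \<in> {0..T} \<Longrightarrow> L2_set (\<gamma> s - \<gamma> t) {..<2 * n} \<le> L * \<bar>s - t\<bar>"
    and ae: "AE t in lebesgue_on {0..T}. (\<forall>i. (\<lambda>s. \<gamma> s i) differentiable (at t)) \<and>
       ?v t \<in> J ` normal_cone (2 * n) (susp_ball n) (\<gamma> t) - {0}"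
    using assms unfolding closed_characteristic_def by blast
  have ball: "\<gamma> t \<in> susp_ball n" if "t \<in> {0..T}" for t
    using frontier [OF that] closedin_susp_ball frontier_of_subset_closedin by blast
  have lip: "\<bar>\<gamma> s i - \<gamma> t i\<bar> \<le> L * \<bar>s - t\<bar>" if "i < 2 * n" "s \<in> {0..T}" "t \<in> {0..T}" for i s t
    using abs_le_L2_set [OF that(1), of "\<gamma> s - \<gamma> t"] L [OF that(2,3)] by (simp add: coord)
  have "AE t in lebesgue. t \<in> {0..T} \<longrightarrow> (\<forall>i. (\<lambda>s. \<gamma> s i) differentiable (at t)) \<and>
       ?v t \<in> J ` normal_cone (2 * n) (susp_ball n) (\<gamma> t) - {0}"
    using ae by (subst (asm) AE_restrict_space_iff) simp_all
  then obtain N where "N \<in> null_sets lebesgue"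
    and N: "\<And>t. t \<in> {0..T} - N \<Longrightarrow> (\<forall>i. (\<lambda>s. \<gamma> s i) differentiable (at t)) \<and>
       ?v t \<in> J ` normal_cone (2 * n) (susp_ball n) (\<gamma> t) - {0}"
    by (auto simp: eventually_ae_filter)
  \<comment> \<open>The endpoints are added because values of the curve outside the period may
    affect the derivatives there.\<close>
  then have negl: "negligible (N \<union> {0, T})"
    by (simp add: negligible_iff_null_sets [symmetric])
  define w where "w t = (if t \<in> {0<..<T} - N then ?v t else 0)" for t
  have norm_w: "susp_norm n (w t) \<le> symp n (\<gamma> t) (w t)" for t
    using N [of t] susp_norm_velocity_le by (auto simp: w_def)
  have w_le: "\<bar>w t i\<bar> \<le> \<bar>L\<bar>" if "i < 2 * n" for t i
  proof (cases "t \<in> {0<..<T} - N")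
    case True
    then have "\<bar>deriv (\<lambda>s. \<gamma> s i) t\<bar> \<le> L"
      using N [of t] by (intro lipschitz_deriv_bound [OF lip [OF that]]) auto
    with True show ?thesis by (simp add: w_def velocity_def)
  qed (auto simp: w_def coord)
  have w_int: "((\<lambda>t. w t i) has_integral \<gamma> q i - \<gamma> p i) {p..q}"
    if "i < 2 * n" "0 \<le> p" "p \<le> q" "q \<le> T" for i p q
  proof -
    have "(deriv (\<lambda>s. \<gamma> s i) has_integral \<gamma> q i - \<gamma> p i) {p..q}"
    proof (rule lipschitz_has_integral_deriv [OF \<open>p \<le> q\<close> _ negl])
      show "\<bar>\<gamma> s i - \<gamma> t i\<bar> \<le> L * \<bar>s - t\<bar>" if "s \<in> {p..q}" "t \<in> {p..q}" for s t
        using that \<open>0 \<le> p\<close> \<open>q \<le> T\<close> by (intro lip \<open>i < 2 * n\<close>) auto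
      show "(\<lambda>s. \<gamma> s i) differentiable at t" if "t \<in> {p<..<q} - (N \<union> {0, T})" for t
        using that \<open>0 \<le> p\<close> \<open>q \<le> T\<close> N [of t] by simp
    qed
    moreover have "w t i = deriv (\<lambda>s. \<gamma> s i) t" if "t \<in> {p..q} - (N \<union> {0, T})" for t
      using that \<open>0 \<le> p\<close> \<open>q \<le> T\<close> by (simp add: w_def velocity_def)
    ultimately show ?thesis
      by (rule has_integral_spike [OF negl, rotated])
  qed
  \<comment> \<open>The bound on the speed comes from estimating the norm of \<open>w t\<close> by
    the sum of its coordinates, each at most \<open>\<bar>L\<bar>\<close>, for a curve inside the
    ball.\<close>
  interpret polar_curve n T \<gamma> w "(\<Sum>i<2 * n. \<bar>L\<bar>)"
  proof
    fix t assume t: "t \<in> {0..T}"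
    then show "\<gamma> t \<in> Rspace (2 * n)"
      using ball by blast
    have w_norm_le: "susp_norm n (w t) \<le> (\<Sum>i<2 * n. \<bar>L\<bar>)"
      using w_le by (intro order_trans [OF susp_norm_le_sum] sum_mono) auto
    have "symp n (\<gamma> t) (w t) \<le> susp_norm n (\<gamma> t) * susp_norm n (w t)"
      using symp_le_susp_norm [of n "\<gamma> t" "w t"] by linarith
    also have "\<dots> \<le> 1 * (\<Sum>i<2 * n. \<bar>L\<bar>)"
      using ball [OF t] by (intro mult_mono w_norm_le susp_norm_nonneg) simp_all
    finally show "symp n (\<gamma> t) (w t) \<le> (\<Sum>i<2 * n. \<bar>L\<bar>)"
      by simp
  next
    have "(\<lambda>t. \<gamma> t i * w t j) absolutely_integrable_on {0..T}" if "i < 2 * n" "j < 2 * n" for i j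
    proof (rule absolutely_integrable_bounded_measurable_product_real)
      have "\<bar>L\<bar>-lipschitz_on {0..T} (\<lambda>t. \<gamma> t i)"
        unfolding lipschitz_on_def dist_real_def
        by (intro conjI ballI order_trans [OF lip [OF that(1)]] mult_right_mono) auto
      then have cont: "continuous_on {0..T} (\<lambda>t. \<gamma> t i)"
        by (rule lipschitz_on_continuous_on)
      then show "(\<lambda>t. \<gamma> t i) \<in> borel_measurable (lebesgue_on {0..T})"
        by (intro continuous_imp_measurable_on_sets_lebesgue) auto
      show "bounded ((\<lambda>t. \<gamma> t i) ` {0..T})"
        using cont by (intro compact_imp_bounded compact_continuous_image) auto
      show "(\<lambda>t. w t j) absolutely_integrable_on {0..T}"
      proof (rule absolutely_integrable_integrable_bound)
        show "(\<lambda>t. w t j) integrable_on {0..T}"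
          using w_int [OF that(2), of 0 T] T by (auto simp: integrable_on_def)
        show "(\<lambda>_. \<bar>L\<bar>) integrable_on {0..T}"
          by (rule integrable_const_ivl)
      qed (use w_le that in auto)
    qed auto
    then show "(\<lambda>t. symp n (\<gamma> t) (w t)) integrable_on {0..T}"
      unfolding symp_def
      by (intro integrable_sum integrable_diff set_lebesgue_integral_eq_integral(1)) auto
  qed (use T closed w_int norm_w in auto)
  have len: "len 0 T = integral {0..T} (\<lambda>t. symp n (\<gamma> t) (?v t))"
    unfolding len_def by (rule integral_spike [OF negl]) (auto simp: w_def)
  have "0 \<le> len 0 T"
    by (rule len_nonneg) auto
  \<comment> \<open>Zero length would make the curve constant, although its velocity is nonzero at
    some interior time off the null set.\<close>
  moreover have "len 0 T \<noteq> 0"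
  proof
    assume "len 0 T = 0"
    have const: "\<gamma> t = \<gamma> 0" if t: "t \<in> {0..T}" for t
    proof -
      have "len 0 t = 0"
        using len_combine [of 0 t T] len_nonneg [of 0 t] len_nonneg [of t T] t \<open>len 0 T = 0\<close> by simp
      then have "susp_norm n (\<gamma> t - \<gamma> 0) = 0"
        using displacement_le_len [of 0 t] susp_norm_nonneg [of n "\<gamma> t - \<gamma> 0"] t by simp
      moreover have "\<gamma> t - \<gamma> 0 \<in> Rspace (2 * n)"
        using t T by (intro Rspace_linear curve) auto
      ultimately show ?thesis
        using susp_norm_eq_0_imp by fastforce
    qed
    obtain t where t: "t \<in> {0<..<T}" "t \<notin> N"
    proof -
      have "\<not> {0<..<T} \<subseteq> N"
        using negl T open_not_negligible [of "{0<..<T}"] negligible_subset [of "N \<union> {0, T}"] by auto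
      then show ?thesis using that by blast
    qed
    have "deriv (\<lambda>s. \<gamma> s i) t = 0" for i
    proof -
      have "\<gamma> s i = \<gamma> 0 i" if "s \<in> {0<..<T}" for s
        using const [of s] that by simp
      moreover have "eventually (\<lambda>s. s \<in> {0<..<T}) (nhds t)"
        using t(1) by (intro eventually_nhds_in_open) simp_all
      ultimately have "eventually (\<lambda>s. \<gamma> s i = \<gamma> 0 i) (nhds t)"
        by (rule eventually_mono [rotated])
      then have "deriv (\<lambda>s. \<gamma> s i) t = deriv (\<lambda>_. \<gamma> 0 i) t"
        by (rule deriv_cong_ev) simp
      then show ?thesis by simp
    qed
    then have "?v t = 0"
      by (simp add: velocity_def zero_fun_def)
    with N [of t] t show False by auto
  qed
  ultimately show ?thesis
    using len_total_le by (intro exI [of _ "len 0 T"]) (auto simp: symp_action_def simp flip: len)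
qed

lemma closed_characteristic_action_ge:
  assumes "closed_characteristic n (susp_ball n) T \<gamma>" and "n \<ge> 1"
  shows "2 + 1 / n \<le> symp_action n T \<gamma>"
proof -
  obtain F where F: "F > 0" "symp_action n T \<gamma> = F / 2" "F \<le> n / (2 * (2 * n + 1)) * F\<^sup>2"
    using closed_characteristic_action [OF assms(1)] by blast
  then have "F * 1 \<le> F * (n / (2 * (2 * n + 1)) * F)"
    by (simp add: power2_eq_square mult_ac)
  then have "1 \<le> n / (2 * (2 * n + 1)) * F"
    using F(1) by (rule mult_left_le_imp_le)
  then have "2 * (2 * n + 1) \<le> n * F"
    by (simp add: field_simps)
  then show ?thesis
    unfolding F(2) using \<open>n \<ge> 1\<close> by (simp add: field_simps)
qed

section \<open>A characteristic of minimal action\<close>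

lemma sum_fun_apply: "(\<Sum>j\<in>I. f j) i = (\<Sum>j\<in>I. f j i)" for f :: "'a \<Rightarrow> nat \<Rightarrow> real"
  by (induction I rule: infinite_finite_induct) (simp_all add: coord)

lemma tail_sum: "tail (\<Sum>j\<in>I. f j) = (\<Sum>j\<in>I. tail (f j))"
  by (induction I rule: infinite_finite_induct) simp_all

text \<open>
  The edges of the extremal polygon: \<open>2n + 1\<close> unit vectors with all mutual areas \<open>1\<close>, so that
  \<open>sum_symp_le\<close> is an equality for them.
\<close>

primrec clique :: "nat \<Rightarrow> nat \<Rightarrow> nat \<Rightarrow> real" where
  "clique 0 j = 0"
| "clique (Suc n) j =
    (if j = 0 then join (vec2 1 0) 0
     else if j = 2 * n + 2 then join (vec2 0 1) 0
     else join (vec2 1 1) (clique n (j - 1)))"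

lemma clique_in_ball: "clique n j \<in> susp_ball n"
proof (induction n arbitrary: j)
  case 0
  then show ?case by (simp add: Rspace_linear)
next
  case (Suc n)
  then show ?case by (simp add: Rspace_linear)
qed

text \<open>In the first plane (1,0), (1,1), (0,1) have area 1 in this order, while two copies of
  (1,1) have area 0 and leave the tails to the induction.\<close>

lemma symp_clique: "i < j \<Longrightarrow> j \<le> 2 * n \<Longrightarrow> symp n (clique n i) (clique n j) = 1"
proof (induction n arbitrary: i j)
  case (Suc n)
  then show ?case
    by (auto simp: symp_Suc)
qed simp

text \<open>The triangle inequality gives only \<open>2 * n + 1\<close>. In the difference of the
  first two coordinates the middle vectors cancel, so each suspension adds just the two outer
  coefficients to the inductive bound.\<close>

lemma susp_norm_clique_sum:
  assumes "\<And>j. j \<le> 2 * n \<Longrightarrow> \<bar>c j\<bar> \<le> 1"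
  shows "susp_norm n (\<Sum>j\<le>2 * n. c j *\<^sub>R clique n j) \<le> 2 * n"
  using assms
proof (induction n arbitrary: c)
  case (Suc n)
  define c' where "c' j = c (Suc j)" for j
  define u where "u = (\<Sum>j\<le>2 * n. c' j *\<^sub>R join (vec2 1 1) (clique n j))"
  have eq: "(\<Sum>j\<le>2 * Suc n. c j *\<^sub>R clique (Suc n) j) =
      c 0 *\<^sub>R join (vec2 1 0) 0 + u + c (2 * n + 2) *\<^sub>R join (vec2 0 1) 0"
    unfolding u_def c'_def
    by (simp add: sum.atMost_Suc_shift [of _ "Suc (2 * n)"] del: sum.atMost_Suc) simp
  define S where "S = (\<Sum>j\<le>2 * n. c' j)"
  have u: "u 0 = S" "u (Suc 0) = S" "tail u = (\<Sum>j\<le>2 * n. c' j *\<^sub>R clique n j)"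
    by (simp_all add: u_def S_def sum_fun_apply tail_sum)
  have c': "\<bar>c' j\<bar> \<le> 1" if "j \<le> 2 * n" for j
    unfolding c'_def using that by (intro Suc.prems) simp
  have "\<bar>S\<bar> \<le> (\<Sum>j\<le>2 * n. 1)"
    unfolding S_def using c' by (intro order_trans [OF sum_abs] sum_mono) auto
  then have S: "\<bar>S\<bar> \<le> 2 * n + 1"
    by simp
  have "\<bar>c 0\<bar> \<le> 1" "\<bar>c (2 * n + 2)\<bar> \<le> 1"
    by (intro Suc.prems; simp)+
  moreover have "susp_norm n (tail u) \<le> 2 * n"
    unfolding u using c' by (intro Suc.IH) auto
  ultimately have "\<bar>c 0 + S\<bar> \<le> 2 * Suc n" "\<bar>S + c (2 * n + 2)\<bar> \<le> 2 * Suc n"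
    "\<bar>c 0 + S - (S + c (2 * n + 2))\<bar> + susp_norm n (tail u) \<le> 2 * Suc n"
    using S by auto
  then show ?case
    unfolding eq susp_norm.simps by (intro max.boundedI) (simp_all add: u(1,2))
qed simp

section \<open>The extremal curve and its derivative\<close>

definition clamp01 :: "real \<Rightarrow> real"
  where "clamp01 x = max 0 (min 1 x)"

lemma clamp01_lipschitz: "\<bar>clamp01 x - clamp01 y\<bar> \<le> \<bar>x - y\<bar>"
  by (auto simp: clamp01_def)

lemma clamp01_simps [simp]: "x \<le> 0 \<Longrightarrow> clamp01 x = 0" "1 \<le> x \<Longrightarrow> clamp01 x = 1"
  "0 \<le> x \<Longrightarrow> x \<le> 1 \<Longrightarrow> clamp01 x = x"
  by (auto simp: clamp01_def)

text \<open>
  In the \<open>j\<close>-th unit of time the \<open>j\<close>-th weight moves from \<open>-1\<close> to \<open>1\<close>; in the second half of the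
  period the weights move back in the same order.
\<close>

definition weight :: "nat \<Rightarrow> nat \<Rightarrow> real \<Rightarrow> real"
  where "weight n j t = 2 * clamp01 (t - j) - 2 * clamp01 (t - (2 * n + 1) - j) - 1"

text \<open>The factor \<open>1 / (2 * n)\<close> puts the curve into the ball by
  \<open>susp_norm_clique_sum\<close>.\<close>

definition optimal_curve :: "nat \<Rightarrow> real \<Rightarrow> nat \<Rightarrow> real"
  where "optimal_curve n t = (1 / (2 * n)) *\<^sub>R (\<Sum>j\<le>2 * n. weight n j t *\<^sub>R clique n j)"

lemma abs_weight_le: "\<bar>weight n j t\<bar> \<le> 1"
proof -
  have "0 \<le> clamp01 (t - (2 * n + 1) - j)" "clamp01 (t - (2 * n + 1) - j) \<le> clamp01 (t - j)"
    "clamp01 (t - j) \<le> 1"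
    by (auto simp: clamp01_def)
  then show ?thesis
    unfolding weight_def by linarith
qed

lemma optimal_curve_in_ball:
  assumes "n \<ge> 1"
  shows "optimal_curve n t \<in> susp_ball n"
proof -
  have "(\<Sum>j\<in>I. weight n j t *\<^sub>R clique n j) \<in> Rspace (2 * n)" for I
    using clique_in_ball
    by (induction I rule: infinite_finite_induct) (auto intro!: Rspace_linear)
  then show ?thesis
    using assms susp_norm_clique_sum [of n "\<lambda>j. weight n j t"] abs_weight_le
    by (simp add: optimal_curve_def Rspace_linear susp_norm_scaleR field_simps)
qed

text \<open>The beginning of the unit of time in which the weight \<open>k\<close> moves in the direction \<open>\<sigma>\<close>.\<close>

definition slot :: "nat \<Rightarrow> real \<Rightarrow> nat \<Rightarrow> real"
  where "slot n \<sigma> k = (if \<sigma> = 1 then k else 2 * n + 1 + k)"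

lemma weight_slot:
  assumes "\<sigma> = 1 \<or> \<sigma> = - 1" "k \<le> 2 * n" "j \<le> 2 * n" "t \<in> {slot n \<sigma> k..slot n \<sigma> k + 1}"
  shows "weight n j t =
    (if j < k then \<sigma> else if k < j then - \<sigma> else \<sigma> * (2 * (t - slot n \<sigma> k) - 1))"
proof -
  consider "j < k" | "j = k" | "k < j" by linarith
  then show ?thesis
    using assms by cases (auto simp: weight_def slot_def field_simps)
qed

text \<open>Every \<open>j\<close> other than \<open>k\<close> contributes 1, since the sign of its
  weight and the sign of its area with \<open>clique n k\<close> both change at \<open>k\<close>;
  these \<open>2 * n\<close> terms match the normalization.\<close>

lemma symp_optimal_curve:
  assumes "n \<ge> 1" "\<sigma> = 1 \<or> \<sigma> = - 1" "k \<le> 2 * n" "t \<in> {slot n \<sigma> k..slot n \<sigma> k + 1}"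
  shows "symp n (optimal_curve n t) (\<sigma> *\<^sub>R clique n k) = 1"
proof -
  have "\<sigma> * (weight n j t * symp n (clique n j) (clique n k)) = (if j = k then 0 else 1)"
    if "j \<le> 2 * n" for j
    using that assms symp_clique [of j k n] symp_clique [of k j n] symp_commute [of n "clique n j" "clique n k"]
    by (auto simp: weight_slot)
  then have "(\<Sum>j\<le>2 * n. \<sigma> * (weight n j t * symp n (clique n j) (clique n k))) =
      (\<Sum>j\<le>2 * n. if j = k then 0 else 1)"
    by (intro sum.cong) auto
  also have "\<dots> = (\<Sum>j\<le>2 * n. 1 - (if j = k then 1 else 0))"
    by (intro sum.cong) auto
  also have "\<dots> = 2 * real n"
    using assms(3) by (simp add: sum_subtractf)
  finally show ?thesis
    using assms(1)
    by (simp add: optimal_curve_def symp_linear symp_sum field_simps flip: sum_distrib_left)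
qed

lemma slot_exhaust:
  assumes "t \<in> {0..2 * (2 * real n + 1)}"
  obtains \<sigma> k where "\<sigma> = 1 \<or> \<sigma> = - 1" "k \<le> 2 * n" "t \<in> {slot n \<sigma> k..slot n \<sigma> k + 1}"
    "t \<notin> real ` {..2 * (2 * n + 1)} \<Longrightarrow> t \<in> {slot n \<sigma> k<..<slot n \<sigma> k + 1}"
proof -
  \<comment> \<open>The cap puts the final time into the last slot instead of one beyond the
    period.\<close>
  define m where "m = min (nat \<lfloor>t\<rfloor>) (4 * n + 1)"
  have m: "m \<le> 4 * n + 1" "m \<le> t" "t \<le> m + 1"
    using assms unfolding m_def min_def by (auto; linarith)+
  have open_m: "m < t \<and> t < m + 1" if "t \<notin> real ` {..2 * (2 * n + 1)}"
  proof -
    have "real m \<in> real ` {..2 * (2 * n + 1)}" "real (m + 1) \<in> real ` {..2 * (2 * n + 1)}"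
      using m(1) by (intro imageI; simp)+
    with that have "t \<noteq> real m" "t \<noteq> real (m + 1)"
      by blast+
    with m show ?thesis by simp
  qed
  show ?thesis
  proof (cases "m \<le> 2 * n")
    case True
    with m open_m show ?thesis
      by (intro that [of 1 m]) (auto simp: slot_def)
  next
    case False
    with m open_m show ?thesis
      by (intro that [of "- 1" "m - (2 * n + 1)"]) (auto simp: slot_def of_nat_diff)
  qed
qed

lemma optimal_curve_diff:
  "optimal_curve n s i - optimal_curve n t i =
    1 / (2 * n) * (\<Sum>j\<le>2 * n. (weight n j s - weight n j t) * clique n j i)"
  unfolding optimal_curve_def coord sum_fun_apply real_scaleR_def right_diff_distrib [symmetric]
    sum_subtractf [symmetric] left_diff_distrib ..

text \<open>Within a slot only the weight \<open>k\<close> moves, at rate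
  \<open>2 * \<sigma>\<close>, so the curve is affine there.\<close>

lemma optimal_curve_deriv:
  assumes "n \<ge> 1" "\<sigma> = 1 \<or> \<sigma> = - 1" "k \<le> 2 * n" "t \<in> {slot n \<sigma> k<..<slot n \<sigma> k + 1}"
  shows "((\<lambda>s. optimal_curve n s i) has_real_derivative \<sigma> / n * clique n k i) (at t)"
proof (rule has_field_derivative_transform_within_open)
  show "((\<lambda>s. optimal_curve n t i + (s - t) * (\<sigma> / n * clique n k i))
      has_real_derivative \<sigma> / n * clique n k i) (at t)"
    using assms(1) by (auto intro!: derivative_eq_intros)
  show "open {slot n \<sigma> k<..<slot n \<sigma> k + 1}" by simp
  show "t \<in> {slot n \<sigma> k<..<slot n \<sigma> k + 1}" by fact
  fix s assume s: "s \<in> {slot n \<sigma> k<..<slot n \<sigma> k + 1}"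
  have "weight n j s - weight n j t = (if j = k then 2 * \<sigma> * (s - t) else 0)" if "j \<le> 2 * n" for j
    using that assms s weight_slot [of \<sigma> k n j s] weight_slot [of \<sigma> k n j t]
    by (auto simp: algebra_simps)
  then have "(\<Sum>j\<le>2 * n. (weight n j s - weight n j t) * clique n j i) =
      (\<Sum>j\<le>2 * n. if j = k then 2 * \<sigma> * (s - t) * clique n j i else 0)"
    by (intro sum.cong) auto
  also have "\<dots> = 2 * \<sigma> * (s - t) * clique n k i"
    using assms(3) by simp
  finally have "optimal_curve n s i - optimal_curve n t i = (s - t) * (\<sigma> / n * clique n k i)"
    unfolding optimal_curve_diff using assms(1) by (simp add: field_simps)
  then show "optimal_curve n t i + (s - t) * (\<sigma> / n * clique n k i) = optimal_curve n s i"
    by simp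
qed

lemma optimal_curve_velocity:
  assumes "n \<ge> 1" "\<sigma> = 1 \<or> \<sigma> = - 1" "k \<le> 2 * n" "t \<in> {slot n \<sigma> k<..<slot n \<sigma> k + 1}"
  shows "velocity (optimal_curve n) t = (1 / n) *\<^sub>R (\<sigma> *\<^sub>R clique n k)"
  using DERIV_imp_deriv [OF optimal_curve_deriv [OF assms]]
  by (simp add: velocity_def fun_eq_iff coord)

lemma J_J: "J (J x) = - x"
proof
  fix i
  show "J (J x) i = (- x) i"
    by (cases "even i") (auto simp: J_def coord elim!: oddE)
qed

text \<open>As \<open>J\<close> squares to minus the identity, the preimage is
  \<open>- J (r *\<^sub>R v)\<close>. Its pairing with \<open>y - x\<close> is
  \<open>r * (symp n y v - 1)\<close>, which self-polarity makes nonpositive.\<close>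

lemma velocity_in_cone:
  assumes "x \<in> susp_ball n" "v \<in> susp_ball n" "symp n x v = 1" "0 < r"
  shows "r *\<^sub>R v \<in> J ` normal_cone (2 * n) (susp_ball n) x - {0}"
proof -
  have J: "r *\<^sub>R v = J (- J (r *\<^sub>R v))"
    using J_J [of "r *\<^sub>R v"] by (simp add: J_def fun_eq_iff coord)
  have "- J (r *\<^sub>R v) \<in> normal_cone (2 * n) (susp_ball n) x"
    unfolding normal_cone_def
  proof (clarify, intro conjI ballI)
    show "- J (r *\<^sub>R v) \<in> Rspace (2 * n)"
      using assms(2) by (intro Rspace_linear J_Rspace) auto
    fix y assume "y \<in> susp_ball n"
    then have "symp n y v \<le> 1"
      using assms(2) symp_polar_susp_ball [of n] unfolding symp_polar_def by blast
    have "dot (2 * n) (- J (r *\<^sub>R v)) (y - x) = symp n (y - x) (r *\<^sub>R v)"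
      unfolding symp_J [symmetric] J [symmetric] ..
    also have "\<dots> \<le> 0"
      using \<open>symp n y v \<le> 1\<close> assms by (simp add: symp_linear mult_le_0_iff)
    finally show "dot (2 * n) (- J (r *\<^sub>R v)) (y - x) \<le> 0" .
  qed
  then have "J (- J (r *\<^sub>R v)) \<in> J ` normal_cone (2 * n) (susp_ball n) x"
    by (rule imageI)
  then have "r *\<^sub>R v \<in> J ` normal_cone (2 * n) (susp_ball n) x"
    by (simp only: J [symmetric])
  moreover have "r *\<^sub>R v \<noteq> 0"
  proof
    assume "r *\<^sub>R v = 0"
    then have "r * symp n x v = 0"
      by (metis symp_linear(8) symp_zero(2))
    with assms show False by simp
  qed
  ultimately show ?thesis
    by blast
qed

lemma optimal_curve_lipschitz:
  "\<exists>L. \<forall>s t. L2_set (optimal_curve n s - optimal_curve n t) {..<2 * n} \<le> L * \<bar>s - t\<bar>"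
proof -
  define L where "L = (\<Sum>i<2 * n. 1 / (2 * n) * (\<Sum>j\<le>2 * n. 4 * \<bar>clique n j i\<bar>))"
  have lip: "\<bar>weight n j s - weight n j t\<bar> \<le> 4 * \<bar>s - t\<bar>" for j s t
  proof -
    define a b where "a = clamp01 (s - j) - clamp01 (t - j)"
      and "b = clamp01 (s - (2 * n + 1) - j) - clamp01 (t - (2 * n + 1) - j)"
    have "\<bar>a\<bar> \<le> \<bar>s - t\<bar>" "\<bar>b\<bar> \<le> \<bar>s - t\<bar>"
      unfolding a_def b_def by (rule order_trans [OF clamp01_lipschitz]; simp)+
    then have "2 * \<bar>a\<bar> + 2 * \<bar>b\<bar> \<le> 4 * \<bar>s - t\<bar>"
      by simp
    moreover have "weight n j s - weight n j t = 2 * a - 2 * b"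
      by (simp add: weight_def a_def b_def)
    ultimately show ?thesis
      using abs_triangle_ineq4 [of "2 * a" "2 * b"] by (simp add: abs_mult)
  qed
  have "L2_set (optimal_curve n s - optimal_curve n t) {..<2 * n} \<le> L * \<bar>s - t\<bar>" for s t
  proof -
    have "\<bar>(optimal_curve n s - optimal_curve n t) i\<bar> \<le>
        1 / (2 * n) * (\<Sum>j\<le>2 * n. 4 * \<bar>clique n j i\<bar>) * \<bar>s - t\<bar>" for i
    proof -
      have "(optimal_curve n s - optimal_curve n t) i =
          1 / (2 * n) * (\<Sum>j\<le>2 * n. (weight n j s - weight n j t) * clique n j i)"
        by (simp only: coord optimal_curve_diff)
      also have "\<bar>\<dots>\<bar> \<le> 1 / (2 * n) * (\<Sum>j\<le>2 * n. 4 * \<bar>s - t\<bar> * \<bar>clique n j i\<bar>)"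
        unfolding abs_mult using lip
        by (intro mult_mono order_trans [OF sum_abs] sum_mono) (auto simp: abs_mult intro: mult_right_mono)
      finally show ?thesis
        by (simp add: sum_distrib_right sum_distrib_left mult_ac)
    qed
    then have "(\<Sum>i<2 * n. \<bar>(optimal_curve n s - optimal_curve n t) i\<bar>) \<le> L * \<bar>s - t\<bar>"
      unfolding L_def sum_distrib_right by (rule sum_mono)
    then show ?thesis
      using L2_set_le_sum_abs order_trans by blast
  qed
  then show ?thesis by blast
qed

lemma optimal_curve_characteristic:
  assumes "n \<ge> 1"
  defines "T \<equiv> 2 * (2 * real n + 1)"
  shows "closed_characteristic n (susp_ball n) T (optimal_curve n)"
    and "symp_action n T (optimal_curve n) = 2 + 1 / n"
proof -
  define Z where "Z = real ` {..2 * (2 * n + 1)}"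
  have Z: "negligible Z"
    by (simp add: Z_def negligible_finite)
  have unit: "\<sigma> *\<^sub>R clique n k \<in> susp_ball n" if "\<sigma> = 1 \<or> \<sigma> = - 1" for \<sigma> k
    using that clique_in_ball [of n k] by (auto simp: Rspace_linear)
  have regular: "(\<forall>i. (\<lambda>s. optimal_curve n s i) differentiable (at t)) \<and>
      velocity (optimal_curve n) t \<in> J ` normal_cone (2 * n) (susp_ball n) (optimal_curve n t) - {0} \<and>
      symp n (optimal_curve n t) (velocity (optimal_curve n) t) = 1 / n"
    if t: "t \<in> {0..T}" "t \<notin> Z" for t
  proof -
    obtain \<sigma> k where *: "\<sigma> = 1 \<or> \<sigma> = - 1" "k \<le> 2 * n" "t \<in> {slot n \<sigma> k<..<slot n \<sigma> k + 1}"
      using slot_exhaust [of t n] t unfolding T_def Z_def by metis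
    then have symp: "symp n (optimal_curve n t) (\<sigma> *\<^sub>R clique n k) = 1"
      by (intro symp_optimal_curve assms) auto
    note v = optimal_curve_velocity [OF assms(1) *]
    have "velocity (optimal_curve n) t \<in> J ` normal_cone (2 * n) (susp_ball n) (optimal_curve n t) - {0}"
      unfolding v using assms(1) *(1) symp
      by (intro velocity_in_cone optimal_curve_in_ball unit) auto
    moreover have "symp n (optimal_curve n t) (velocity (optimal_curve n) t) = 1 / n"
      unfolding v symp_linear(8) [of _ _ "1 / n"] symp by simp
    moreover have "(\<lambda>s. optimal_curve n s i) differentiable (at t)" for i
      using optimal_curve_deriv [OF assms(1) *] real_differentiable_def by blast
    ultimately show ?thesis by blast
  qed
  have "AE t in lebesgue_on {0..T}.
      (\<forall>i. (\<lambda>s. optimal_curve n s i) differentiable (at t)) \<and>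
      velocity (optimal_curve n) t \<in> J ` normal_cone (2 * n) (susp_ball n) (optimal_curve n t) - {0}"
    (is "AE t in _. ?R t")
  proof (subst AE_restrict_space_iff)
    have "Z \<in> null_sets lebesgue"
      using Z by (simp add: negligible_iff_null_sets)
    then show "AE t in lebesgue. t \<in> {0..T} \<longrightarrow> ?R t"
    proof (rule AE_I')
      show "{t \<in> space lebesgue. \<not> (t \<in> {0..T} \<longrightarrow> ?R t)} \<subseteq> Z"
      proof
        fix t assume "t \<in> {t \<in> space lebesgue. \<not> (t \<in> {0..T} \<longrightarrow> ?R t)}"
        then have "t \<in> {0..T}" "\<not> ?R t" by blast+
        with regular [of t] show "t \<in> Z" by blast
      qed
    qed
  qed simp
  moreover have "optimal_curve n t \<in> Euclidean_space (2 * n) frontier_of susp_ball n"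
    if t: "t \<in> {0..T}" for t
  proof -
    obtain \<sigma> k where *: "\<sigma> = 1 \<or> \<sigma> = - 1" "k \<le> 2 * n" "t \<in> {slot n \<sigma> k..slot n \<sigma> k + 1}"
      using slot_exhaust [of t n] t unfolding T_def by metis
    then show ?thesis
      by (intro frontier_susp_ball [OF _ unit symp_optimal_curve] optimal_curve_in_ball assms)
  qed
  moreover have "optimal_curve n 0 = optimal_curve n T"
  proof -
    have "weight n j 0 = weight n j T" if "j \<le> 2 * n" for j
      using that by (simp add: weight_def T_def)
    then show ?thesis
      by (simp add: optimal_curve_def)
  qed
  ultimately show "closed_characteristic n (susp_ball n) T (optimal_curve n)"
    unfolding closed_characteristic_def using optimal_curve_lipschitz [of n]
    by (auto simp: T_def)
  \<comment> \<open>The integrand is \<open>1 / n\<close> off the corner times, and the period is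
    \<open>4 * n + 2\<close>.\<close>
  have "integral {0..T} (\<lambda>t. symp n (optimal_curve n t) (velocity (optimal_curve n) t)) =
      integral {0..T} (\<lambda>t. 1 / n)"
    using regular by (intro integral_spike [OF Z]) auto
  also have "\<dots> = 2 * (2 + 1 / n)"
    using assms(1) by (simp add: T_def field_simps)
  finally show "symp_action n T (optimal_curve n) = 2 + 1 / n"
    by (simp add: symp_action_def)
qed

theorem theorem1p2:
  fixes n :: nat
  assumes "n \<ge> 1"
  shows "symp_self_polar n (P_power n) \<and> polytope (P_power n) \<and>
         c_EHZ n (P_power n) = 2 + 1 / real n"
proof (intro conjI)
  note [simp] = P_power_eq_susp_ball [OF assms]
  show "symp_self_polar n (P_power n)"
    using symp_self_polar_susp_ball by simp
  show "polytope (P_power n)"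
    using polytope_susp_ball by simp
  show "c_EHZ n (P_power n) = 2 + 1 / real n"
    unfolding c_EHZ_def
  proof (rule Least_equality)
    show "\<exists>T \<gamma>. closed_characteristic n (P_power n) T \<gamma> \<and> 2 + 1 / real n = symp_action n T \<gamma>"
      using optimal_curve_characteristic [OF assms] by (metis P_power_eq_susp_ball assms)
  qed (use closed_characteristic_action_ge assms in auto)
qed

end
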